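(* Let $q$ be a prime power and let $\ell\ge 0$ be a fixed integer. Let $k$ and $n$ range over positive integers with $\ell\leq k\leq n-\ell$. Then $$\lim_{\substack{k\rightarrow \infty \\ (n-k)\rightarrow\infty}}\frac{|{\rm HHull}[n,k]_{q^2}^\ell|}{\begin{bmatrix} n \\ k \end{bmatrix}_{q^2}}=\frac{q^\ell\cdot g_{q,\infty}\cdot g_{q^4,\infty}}{h_{q^2,\ell}\cdot g_{q^2,\infty}\cdot g_{q^2,\infty}}.$$ In particular, if $\ell=0$, then $$\lim_{\substack{k\rightarrow \infty \\ (n-k)\rightarrow\infty}}\frac{|{\rm HHull}[n,k]_{q^2}^0|}{\begin{bmatrix} n \\ k \end{bmatrix}_{q^2}}=\frac{g_{q,\infty}\cdot g_{q^4,\infty}}{g_{q^2,\infty}\cdot g_{q^2,\infty}}.$$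
   Context: $\mathbb{F}_{q^2}$ is the field with $q^2$ elements. A linear $[n,k]_{q^2}$ code is a $k$-dimensional subspace $C$ of $\mathbb{F}_{q^2}^n$. The Hermitian inner product is $\langle \mathbf{x},\mathbf{y}\rangle_{\rm H}=\sum_{i=1}^n x_iy_i^q$, and $C^{\perp_{\rm H}}=\{\mathbf{y}\in\mathbb{F}_{q^2}^n : \langle \mathbf{x},\mathbf{y}\rangle_{\rm H}=0 \text{ for all } \mathbf{x}\in C\}$. The Hermitian hull of $C$ is ${\rm Hull_H}(C)=C\cap C^{\perp_{\rm H}}$. ${\rm HHull}[n,k]^{\ell}_{q^2}$ denotes the set of all linear $[n,k]_{q^2}$ codes whose Hermitian hull has dimension $\ell$. For real $Q>1$: the Gaussian binomial coefficient is $\begin{bmatrix} n\\k\end{bmatrix}_Q=\frac{(Q^n-1)(Q^n-Q)\cdots(Q^n-Q^{k-1})}{(Q^k-1)(Q^k-Q)\cdots(Q^k-Q^{k-1})}$ for $k\ne0$ and $\begin{bmatrix} n\\0\end{bmatrix}_Q=1$; $g_{Q,n}=\prod_{i=1}^n\left(1-\frac{1}{Q^i}\right)$ and $g_{Q,\infty}=\lim_{n\to\infty}g_{Q,n}$ (a positive limit); $h_{Q,\ell}=\prod_{i=1}^{\ell}(Q^i-1)$, with $h_{Q,0}=1$. The limit means: for every $\varepsilon>0$ there is $M$ such that the quotient is within $\varepsilon$ of the stated value whenever $k\ge M$ and $n-k\ge M$. *)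

theory Defs
  imports
    Complex_Main
    "HOL-Library.Cardinality"
    "HOL-Library.Function_Algebras"
    "HOL-Number_Theory.Prime_Powers"
begin

text \<open>
  Vectors are functions on the natural numbers with pointwise operations.  Since the length has to
  vary within one statement, the space of vectors of length \<open>n\<close> is the subspace of the functions
  supported on \<open>{..<n}\<close> (so coordinates are numbered from \<open>0\<close> to \<open>n - 1\<close>).
\<close>

definition vscale :: "'a::field \<Rightarrow> (nat \<Rightarrow> 'a) \<Rightarrow> nat \<Rightarrow> 'a" where
  "vscale c x = (\<lambda>i. c * x i)"

interpretation fn: vector_space "vscale :: 'a::field \<Rightarrow> (nat \<Rightarrow> 'a) \<Rightarrow> nat \<Rightarrow> 'a"
  by unfold_locales (auto simp: vscale_def fun_eq_iff algebra_simps)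

definition vecs :: "nat \<Rightarrow> (nat \<Rightarrow> 'a::field) set" where
  "vecs n = {x. \<forall>i\<ge>n. x i = 0}"

definition linear_codes :: "nat \<Rightarrow> nat \<Rightarrow> (nat \<Rightarrow> 'a::field) set set" where
  "linear_codes n k = {C. C \<subseteq> vecs n \<and> fn.subspace C \<and> fn.dim C = k}"

text \<open>
  The Hermitian notions below carry \<open>q\<close> as an explicit parameter; they are meant for a field
  with \<open>q\<^sup>2\<close> elements.
\<close>

definition herm_inner :: "nat \<Rightarrow> nat \<Rightarrow> (nat \<Rightarrow> 'a::field) \<Rightarrow> (nat \<Rightarrow> 'a) \<Rightarrow> 'a" where
  "herm_inner q n x y = (\<Sum>i<n. x i * y i ^ q)"

definition herm_dual :: "nat \<Rightarrow> nat \<Rightarrow> (nat \<Rightarrow> 'a::field) set \<Rightarrow> (nat \<Rightarrow> 'a) set" where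
  "herm_dual q n C = {y \<in> vecs n. \<forall>x\<in>C. herm_inner q n x y = 0}"

definition herm_hull :: "nat \<Rightarrow> nat \<Rightarrow> (nat \<Rightarrow> 'a::field) set \<Rightarrow> (nat \<Rightarrow> 'a) set" where
  "herm_hull q n C = C \<inter> herm_dual q n C"

definition HHull :: "nat \<Rightarrow> nat \<Rightarrow> nat \<Rightarrow> nat \<Rightarrow> (nat \<Rightarrow> 'a::field) set set" where
  "HHull q n k l = {C \<in> linear_codes n k. fn.dim (herm_hull q n C) = l}"

text \<open>For \<open>k = 0\<close> both products are empty, so the value is \<open>1\<close>.\<close>

definition gauss_binomial :: "real \<Rightarrow> nat \<Rightarrow> nat \<Rightarrow> real" where
  "gauss_binomial Q n k = (\<Prod>i<k. (Q ^ n - Q ^ i)) / (\<Prod>i<k. (Q ^ k - Q ^ i))"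

definition g_fin :: "real \<Rightarrow> nat \<Rightarrow> real" where
  "g_fin Q n = (\<Prod>i=1..n. (1 - 1 / Q ^ i))"

definition g_inf :: "real \<Rightarrow> real" where
  "g_inf Q = lim (g_fin Q)"

definition h_fin :: "real \<Rightarrow> nat \<Rightarrow> real" where
  "h_fin Q l = (\<Prod>i=1..l. (Q ^ i - 1))"

text \<open>
  The limit of \<open>f n k\<close> as both \<open>k\<close> and \<open>n - k\<close> tend to infinity, over the positive integers
  \<open>k\<close>, \<open>n\<close> with \<open>l \<le> k \<le> n - l\<close>.  The upper bound is written without truncated subtraction;
  it ensures that \<open>n - k\<close> below is a genuine difference.
\<close>

definition tends_to_dim_codim :: "nat \<Rightarrow> (nat \<Rightarrow> nat \<Rightarrow> real) \<Rightarrow> real \<Rightarrow> bool" where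
  "tends_to_dim_codim l f L \<longleftrightarrow>
     (\<forall>\<epsilon>>0. \<exists>M. \<forall>n k. 0 < n \<and> 0 < k \<and> l \<le> k \<and> k + l \<le> n \<and> M \<le> k \<and> M \<le> n - k \<longrightarrow>
        \<bar>f n k - L\<bar> < \<epsilon>)"

end

theory Submission
  imports Defs "HOL-Computational_Algebra.Polynomial" "HOL-Analysis.Infinite_Products"
begin

text \<open>
  The vectors of given norm in a Hermitian space of given dimension and radical are counted by
  splitting off a unit vector: since the norm map has fibres of size \<open>q + 1\<close> over the nonzero
  elements of the fixed field, this gives a linear recursion in the rank.  Now count the tuples that
  consist of \<open>k - l\<close> orthonormal vectors followed by \<open>l\<close> linearly independent isotropic ones, all
  mutually orthogonal, in two ways: vector by vector in the whole space, and inside their span, which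
  is a code with a hull of dimension \<open>l\<close>.  Both counts are products, so the number of codes is a
  quotient of products \<open>\<Prod>i. (1 - (- 1 / q) ^ i)\<close>.  Divided by the Gaussian binomial it tends to
  \<open>q ^ l * g(q\<^sup>2) / (h(q\<^sup>2, l) * f)\<close> for the infinite product \<open>f\<close> of this form, and
  \<open>f * g(q) * g(q ^ 4) = g(q\<^sup>2) ^ 3\<close>.
\<close>

section \<open>Finite fields and vector spaces\<close>

lemma card_roots_monom_bound:
  fixes c :: "'a::field"
  assumes "0 < n"
  shows "finite {a. a ^ n = c}" "card {a. a ^ n = c} \<le> n"
proof -
  let ?p = "monom 1 n - [:c:]"
  have "coeff ?p n = 1" using assms by (simp add: coeff_pCons split: nat.split)
  hence p: "?p \<noteq> 0" by (metis coeff_0 zero_neq_one)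
  have "degree ?p \<le> n" using assms by (intro degree_diff_le) (auto simp: degree_monom_le)
  moreover have "{a. a ^ n = c} = {a. poly ?p a = 0}" by (auto simp: poly_monom)
  ultimately show "finite {a. a ^ n = c}" "card {a. a ^ n = c} \<le> n"
    using poly_roots_finite[OF p] card_poly_roots_bound[OF p] by auto
qed

text \<open>Two representations with different coefficients of \<open>w\<close> would put a nonzero
  multiple of \<open>w\<close> into \<open>W\<close>. The parametrisation is kept, and not just the
  cardinality, since vectors of given norm are later counted through it.\<close>

lemma bij_betw_span_insert:
  fixes W :: "(nat \<Rightarrow> 'a::field) set"
  assumes "fn.subspace W" "w \<notin> W"
  shows "bij_betw (\<lambda>(a, y). vscale a w + y) (UNIV \<times> W) (fn.span (insert w W))"
proof (rule bij_betw_imageI)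
  have eq: "a = b \<and> y = z"
    if h: "vscale a w + y = vscale b w + z" and yz: "y \<in> W" "z \<in> W" for a b y z
  proof (cases "a = b")
    case False
    have "vscale (a - b) w = z - y" using h by (simp add: fn.scale_left_diff_distrib algebra_simps)
    hence "vscale (a - b) w \<in> W" using yz assms(1) by (simp add: fn.subspace_diff)
    hence "w \<in> W" using False assms(1) fn.subspace_scale[of W "vscale (a-b) w" "inverse (a-b)"]
      by simp
    thus ?thesis using assms by simp
  qed (use h in simp)
  thus "inj_on (\<lambda>(a, y). vscale a w + y) (UNIV \<times> W)"
    by (auto simp: inj_on_def)
  have sp: "fn.span W = W" using assms(1) by simp
  show "(\<lambda>(a, y). vscale a w + y) ` (UNIV \<times> W) = fn.span (insert w W)"
    unfolding fn.span_insert sp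
  proof safe
    fix a y assume "y \<in> W"
    thus "\<exists>k. vscale a w + y - vscale k w \<in> W" by (intro exI[of _ a]) simp
  next
    fix x k assume "x - vscale k w \<in> W"
    thus "x \<in> (\<lambda>(a, y). vscale a w + y) ` (UNIV \<times> W)"
      by (intro image_eqI[of _ _ "(k, x - vscale k w)"]) auto
  qed
qed

lemma card_span_insert:
  fixes W :: "(nat \<Rightarrow> 'a::{field,finite}) set"
  assumes "fn.subspace W" "w \<notin> W"
  shows "card (fn.span (insert w W)) = CARD('a) * card W"
  using bij_betw_same_card[OF bij_betw_span_insert[OF assms]] by (simp add: card_cartesian_product)

lemma card_span_independent:
  fixes B :: "(nat \<Rightarrow> 'a::{field,finite}) set"
  assumes "finite B" "fn.independent B"
  shows "card (fn.span B) = CARD('a) ^ card B"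
  using assms
proof (induction B)
  case (insert x B)
  hence "x \<notin> fn.span B" "fn.independent B" by (auto simp: fn.independent_insert)
  moreover have "fn.span (insert x (fn.span B)) = fn.span (insert x B)"
    by (simp add: fn.span_insert fn.span_span)
  ultimately show ?case using insert card_span_insert[of "fn.span B" x] by simp
qed simp

lemma one_less_CARD_field: "1 < CARD('a::{field,finite})"
  using card_mono[of UNIV "{0, 1 :: 'a}"] by simp

text \<open>Since the field has more than one element, the exponent of the cardinality determines
  the dimension. Codes and radicals can thus be handled by counting alone.\<close>

lemma dim_eq_iff_card:
  fixes W :: "(nat \<Rightarrow> 'a::{field,finite}) set"
  assumes "finite W" "fn.subspace W"
  shows "fn.dim W = d \<longleftrightarrow> card W = CARD('a) ^ d"
proof -
  obtain B where B: "B \<subseteq> W" "fn.independent B" "W \<subseteq> fn.span B" "card B = fn.dim W"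
    by (rule fn.basis_exists)
  have "fn.span B = W" using B assms by (intro fn.span_subspace) auto
  hence "card W = CARD('a) ^ fn.dim W"
    using card_span_independent[of B] B assms finite_subset by metis
  thus ?thesis using one_less_CARD_field[where 'a='a] by simp
qed

lemma bij_betw_vecs:
  "bij_betw (\<lambda>x. restrict x {..<n}) (vecs n :: (nat \<Rightarrow> 'a::field) set) ({..<n} \<rightarrow>\<^sub>E UNIV)"
proof (rule bij_betw_byWitness[where f' = "\<lambda>y i. if i < n then y i else 0"])
qed (auto simp: vecs_def fun_eq_iff PiE_def extensional_def restrict_def)

lemma card_vecs: "card (vecs n :: (nat \<Rightarrow> 'a::{field,finite}) set) = CARD('a) ^ n"
  using bij_betw_same_card[OF bij_betw_vecs[of n, where 'a='a]] by (simp add: card_PiE)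

lemma finite_vecs: "finite (vecs n :: (nat \<Rightarrow> 'a::{field,finite}) set)"
  using bij_betw_finite[OF bij_betw_vecs[of n, where 'a='a]] by (simp add: finite_PiE)

lemma subspace_vecs: "fn.subspace (vecs n)"
  by (auto simp: fn.subspace_def vecs_def vscale_def)

text \<open>Multiplication by a nonzero \<open>x\<close> permutes the nonzero elements, so the
  factor \<open>x ^ (CARD('a) - 1)\<close> leaves their product unchanged.\<close>

lemma field_power_CARD: "x ^ CARD('a) = (x :: 'a::{field,finite})"
proof (cases "x = 0")
  case False
  let ?P = "\<Prod>y\<in>UNIV - {0 :: 'a}. y"
  have "?P = (\<Prod>y\<in>UNIV - {0}. x * y)"
    by (rule prod.reindex_bij_witness[of _ "\<lambda>y. x * y" "\<lambda>y. y / x"]) (use False in auto)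
  also have "\<dots> = x ^ (CARD('a) - 1) * ?P" by (simp add: prod.distrib card_Diff_subset)
  finally have "x ^ (CARD('a) - 1) = 1" by simp
  thus ?thesis using power_Suc[of x "CARD('a) - 1"] one_less_CARD_field[where 'a='a] by simp
qed (simp add: power_0_left)

text \<open>Translation by \<open>1\<close> permutes the field; comparing the sums of all elements
  before and after shows that \<open>CARD('a)\<close> vanishes in it.\<close>

lemma CHAR_dvd_CARD_field: "CHAR('a::{field,finite}) dvd CARD('a)"
proof -
  have "(\<Sum>x\<in>UNIV. x + 1) = (\<Sum>x\<in>UNIV. x :: 'a)"
    by (rule sum.reindex_bij_witness[of _ "\<lambda>x. x - 1" "\<lambda>x. x + 1"]) auto
  hence "of_nat CARD('a) = (0 :: 'a)" by (simp add: sum.distrib)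
  thus ?thesis by (simp add: of_nat_eq_0_iff_char_dvd)
qed

section \<open>Hermitian spaces\<close>

locale hermitian =
  fixes q :: nat and ty :: "'a::{field,finite} itself" and n :: nat
  assumes primepow_q: "primepow q" and CARD: "CARD('a) = q ^ 2"
begin

lemma q_gt_1: "1 < q"
  using primepow_gt_Suc_0[OF primepow_q] by simp

abbreviation B :: "(nat \<Rightarrow> 'a) \<Rightarrow> (nat \<Rightarrow> 'a) \<Rightarrow> 'a" where "B \<equiv> herm_inner q n"

text \<open>The characteristic divides \<open>q ^ 2\<close>, hence is the prime of which
  \<open>q\<close> is a power. So raising to the power \<open>q\<close> is an iterated Frobenius
  map, which makes it additive.\<close>

lemma CHAR_power: "prime CHAR('a)" "\<exists>e. q = CHAR('a) ^ e"
proof -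
  obtain p e where p: "prime p" "e > 0" "q = p ^ e" using primepow_q by (auto simp: primepow_def)
  show pr: "prime CHAR('a)" by (rule prime_CHAR_semidom) (simp add: finite_imp_CHAR_pos)
  have "CHAR('a) dvd (p ^ e)\<^sup>2" using CHAR_dvd_CARD_field[where 'a='a] CARD p by simp
  hence "CHAR('a) dvd p" using pr prime_dvd_power by blast
  hence "CHAR('a) = p" using pr p primes_dvd_imp_eq by blast
  thus "\<exists>e. q = CHAR('a) ^ e" using p by blast
qed

section \<open>Conjugation, norm and trace\<close>

lemma conj_add: "(x + y :: 'a) ^ q = x ^ q + y ^ q"
  using CHAR_power by (auto intro: freshmans_dream')

lemma conj_sum: "(sum f A :: 'a) ^ q = (\<Sum>i\<in>A. f i ^ q)"
  using CHAR_power by (auto intro: freshmans_dream_sum')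

lemma conj_zero [simp]: "(0::'a) ^ q = 0" using q_gt_1 by simp

lemma conj_conj [simp]: "((x::'a) ^ q) ^ q = x"
  using field_power_CARD[of x] CARD by (simp add: power2_eq_square power_mult)

lemma conj_minus: "(- x :: 'a) ^ q = - (x ^ q)"
  using conj_add[of x "-x"] by (simp add: eq_neg_iff_add_eq_0 add.commute)

lemma conj_diff: "(x - y :: 'a) ^ q = x ^ q - y ^ q"
  using conj_add[of x "-y"] by (simp add: conj_minus)

text \<open>The norm sends the \<open>q ^ 2 - 1\<close> nonzero elements to roots of
  \<open>c ^ (q - 1) = 1\<close>, of which there are at most \<open>q - 1\<close>, and each fibre
  has at most \<open>q + 1\<close> elements. As \<open>(q - 1) * (q + 1) = q ^ 2 - 1\<close>, no
  fibre can be smaller.\<close>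

lemma card_norm_fibre:
  assumes c: "(c::'a) ^ q = c" "c \<noteq> 0"
  shows "card {a. a ^ (q + 1) = c} = q + 1"
proof -
  let ?F = "{c::'a. c ^ (q - 1) = 1}"
  let ?fib = "\<lambda>c::'a. {a. a ^ (q + 1) = c}"
  have q: "1 < q" by (rule q_gt_1)
  have F_iff: "x \<in> ?F \<longleftrightarrow> x ^ q = x \<and> x \<noteq> 0" for x :: 'a
    using q power_Suc[of x "q - 1"] by (cases "x = 0") (auto simp: power_0_left)
  have F: "finite ?F" "card ?F \<le> q - 1" using card_roots_monom_bound[of "q - 1" "1::'a"] q by auto
  have fib: "card (?fib c) \<le> q + 1" for c :: 'a
    using card_roots_monom_bound(2)[of "q + 1" c] by simp
  have un: "UNIV - {0::'a} = (\<Union>c\<in>?F. ?fib c)"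
  proof (rule set_eqI)
    fix a :: 'a
    have "(a ^ (q + 1)) ^ q = a ^ (q + 1)"
      using conj_conj[of a] by (metis power_add power_mult_distrib power_one_right mult.commute)
    thus "a \<in> UNIV - {0} \<longleftrightarrow> a \<in> (\<Union>c\<in>?F. ?fib c)"
      unfolding UN_iff Bex_def F_iff by auto
  qed
  have "q\<^sup>2 - 1 = card (UNIV - {0::'a})" using CARD by (simp add: card_Diff_subset)
  also have "\<dots> = (\<Sum>c\<in>?F. card (?fib c))"
    unfolding un by (rule card_UN_disjoint) (use F in auto)
  finally have sum: "(\<Sum>c\<in>?F. card (?fib c)) = q\<^sup>2 - 1" ..
  have cF: "c \<in> ?F" using c F_iff by simp
  show ?thesis
  proof (rule ccontr)
    assume "card (?fib c) \<noteq> q + 1"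
    hence "card (?fib c) < q + 1" using fib[of c] by simp
    hence "(\<Sum>c\<in>?F. card (?fib c)) < (\<Sum>c\<in>?F. q + 1)"
      using F cF fib by (intro sum_strict_mono_ex1) auto
    also have "\<dots> \<le> (q - 1) * (q + 1)" using F(2) by (simp add: mult_le_mono1 del: mult_Suc_right)
    also have "\<dots> = q\<^sup>2 - 1" by (simp add: power2_eq_square algebra_simps)
    finally show False using sum by simp
  qed
qed

lemma norm_surj:
  assumes "(c::'a) ^ q = c"
  obtains a where "a ^ (q + 1) = c"
proof (cases "c = 0")
  case False
  hence "{a. a ^ (q + 1) = c} \<noteq> {}" using card_norm_fibre[OF assms] by force
  thus ?thesis using that by auto
qed (use that[of 0] in simp)

text \<open>If the trace vanished identically, all \<open>q ^ 2 - 1\<close> nonzero elements would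
  be roots of \<open>x ^ (q - 1) = -1\<close>, which has at most \<open>q - 1\<close> roots. The
  argument covers characteristic 2 as well.\<close>

lemma trace_nonzero: "\<exists>t::'a. t + t ^ q \<noteq> 0"
proof (rule ccontr)
  assume "\<not> ?thesis"
  hence t: "t ^ q = - t" for t :: 'a by (simp add: eq_neg_iff_add_eq_0 add.commute)
  have "UNIV - {0::'a} \<subseteq> {t. t ^ (q - 1) = -1}"
  proof safe
    fix x :: 'a assume "x \<noteq> 0"
    moreover have "x * x ^ (q - 1) = x * (-1)"
      using t[of x] power_Suc[of x "q - 1"] q_gt_1 by simp
    ultimately show "x ^ (q - 1) = -1" by (metis mult_left_cancel)
  qed
  hence "card (UNIV - {0::'a}) \<le> q - 1"
    using card_roots_monom_bound[of "q - 1" "-1::'a"] q_gt_1 card_mono[of "{t. t ^ (q - 1) = -1}" "UNIV - {0::'a}"]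
    by linarith
  hence "q\<^sup>2 - 1 \<le> q - 1" using CARD by (simp add: card_Diff_subset)
  moreover have "q < q\<^sup>2" using q_gt_1 by (simp add: power2_eq_square)
  ultimately show False using q_gt_1 by linarith
qed

section \<open>The Hermitian form, orthogonal complements and radicals\<close>

lemma B_add_left: "B (x + y) z = B x z + B y z"
  by (simp add: herm_inner_def algebra_simps sum.distrib)

lemma B_scale_left: "B (vscale a x) z = a * B x z"
  by (simp add: herm_inner_def vscale_def sum_distrib_left algebra_simps)

lemma B_conj: "B x y ^ q = B y x"
  by (simp add: herm_inner_def conj_sum power_mult_distrib mult.commute)

lemma B_add_right: "B z (x + y) = B z x + B z y"
  by (simp add: herm_inner_def conj_add algebra_simps sum.distrib)

lemma B_scale_right: "B z (vscale a x) = a ^ q * B z x"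
  by (simp add: herm_inner_def vscale_def sum_distrib_left power_mult_distrib algebra_simps)

lemma B_zero_left [simp]: "B 0 z = 0" and B_zero_right [simp]: "B z 0 = 0"
  by (simp_all add: herm_inner_def)

lemma B_diff_left: "B (x - y) z = B x z - B y z"
  using B_add_left[of "x - y" y z] by simp

lemmas B_simps = B_add_left B_scale_left B_add_right B_scale_right B_diff_left

lemma B_orth_commute: "B x y = 0 \<longleftrightarrow> B y x = 0"
  by (metis B_conj conj_zero)

definition perp :: "(nat \<Rightarrow> 'a) \<Rightarrow> (nat \<Rightarrow> 'a) set" where "perp w = {x. B x w = 0}"

text \<open>The radical of the form restricted to \<open>W\<close>; for a code it is the hull. It
  does not mention \<open>vecs n\<close>, so it can be followed through successive orthogonal
  complements.\<close>

definition rad :: "(nat \<Rightarrow> 'a) set \<Rightarrow> (nat \<Rightarrow> 'a) set" where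
  "rad W = {x \<in> W. \<forall>y\<in>W. B x y = 0}"

lemma subspace_perp: "fn.subspace (perp w)"
  by (auto simp: fn.subspace_def perp_def B_simps)

lemma subspace_Int_perp: "fn.subspace W \<Longrightarrow> fn.subspace (W \<inter> perp w)"
  by (intro fn.subspace_inter subspace_perp)

lemma subspace_rad: "fn.subspace W \<Longrightarrow> fn.subspace (rad W)"
  by (auto simp: fn.subspace_def rad_def B_simps)

lemma rad_subset: "rad W \<subseteq> W" by (auto simp: rad_def)

lemma herm_hull_eq_rad: "W \<subseteq> vecs n \<Longrightarrow> herm_hull q n W = rad W"
  using B_orth_commute by (auto simp: herm_hull_def herm_dual_def rad_def)

text \<open>Pairing with a standard basis vector reads off a coordinate below \<open>n\<close>, and
  the other coordinates vanish on \<open>vecs n\<close>.\<close>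

lemma rad_vecs: "rad (vecs n) = {0}"
proof -
  have "x = 0" if x: "x \<in> rad (vecs n)" for x
  proof
    fix i :: nat
    let ?e = "\<lambda>j. if j = i then 1 else 0 :: 'a"
    show "x i = 0 i"
    proof (cases "i < n")
      case True
      hence "?e \<in> vecs n" by (auto simp: vecs_def)
      hence "B x ?e = 0" using x by (auto simp: rad_def)
      moreover have "B x ?e = (\<Sum>j<n. if j = i then x j else 0)"
        unfolding herm_inner_def by (intro sum.cong) auto
      ultimately show ?thesis using True by simp
    qed (use x in \<open>auto simp: rad_def vecs_def\<close>)
  qed
  moreover have "0 \<in> rad (vecs n)" using subspace_rad[OF subspace_vecs] fn.subspace_0 by blast
  ultimately show ?thesis by blast
qed

text \<open>Subtracting the right multiple of \<open>v\<close> from a vector makes it orthogonal to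
  \<open>w\<close>. Allowing \<open>v\<close> to differ from \<open>w\<close> covers isotropic
  \<open>w\<close>.\<close>

lemma span_insert_perp:
  assumes W: "fn.subspace W" and v: "v \<in> W" "B v w \<noteq> 0"
  shows "fn.span (insert v (W \<inter> perp w)) = W"
proof
  show "fn.span (insert v (W \<inter> perp w)) \<subseteq> W"
    using assms by (intro fn.span_minimal) auto
  show "W \<subseteq> fn.span (insert v (W \<inter> perp w))"
  proof
    fix x assume x: "x \<in> W"
    let ?k = "B x w / B v w"
    have "x - vscale ?k v \<in> W \<inter> perp w"
      using x v W by (auto simp: fn.subspace_diff fn.subspace_scale perp_def B_simps)
    thus "x \<in> fn.span (insert v (W \<inter> perp w))"
      unfolding fn.span_insert by (auto intro: fn.span_base)
  qed
qed

lemma card_Int_perp: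
  assumes W: "fn.subspace W" and v: "v \<in> W" "B v w \<noteq> 0"
  shows "card W = q\<^sup>2 * card (W \<inter> perp w)"
  using card_span_insert[OF subspace_Int_perp[OF W], of v w] span_insert_perp[OF assms] v CARD
  by (auto simp: perp_def)

text \<open>\<open>W\<close> is spanned by \<open>w\<close> and its complement, and a radical vector
  of the complement is orthogonal to both.\<close>

lemma rad_Int_perp_anisotropic:
  assumes W: "fn.subspace W" and w: "w \<in> W" "B w w \<noteq> 0"
  shows "rad (W \<inter> perp w) = rad W"
proof
  show "rad W \<subseteq> rad (W \<inter> perp w)" using w by (auto simp: rad_def perp_def)
  show "rad (W \<inter> perp w) \<subseteq> rad W"
  proof
    fix x assume x: "x \<in> rad (W \<inter> perp w)"
    have "B x y = 0" if "y \<in> W" for y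
    proof -
      have "y \<in> fn.span (insert w (W \<inter> perp w))" using that span_insert_perp[OF assms] by simp
      then obtain k where k: "y - vscale k w \<in> W \<inter> perp w"
        using subspace_Int_perp[OF W, of w] by (auto simp: fn.span_insert simp flip: fn.span_eq_iff)
      have "B x y = B x ((y - vscale k w) + vscale k w)" by simp
      also have "\<dots> = 0" unfolding B_add_right B_scale_right using x k by (auto simp: rad_def perp_def)
      finally show ?thesis .
    qed
    thus "x \<in> rad W" using x by (auto simp: rad_def)
  qed
qed

text \<open>\<open>u\<close> lies in its own complement and so becomes radical there. Conversely,
  take \<open>v\<close> in \<open>W\<close> not orthogonal to \<open>u\<close>: a radical vector of
  the complement, corrected by the multiple of \<open>u\<close> that makes it orthogonal to
  \<open>v\<close>, is orthogonal to all of \<open>W\<close>.\<close>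

lemma rad_Int_perp_isotropic:
  assumes W: "fn.subspace W" and u: "u \<in> W" "B u u = 0" "u \<notin> rad W"
  shows "rad (W \<inter> perp u) = fn.span (insert u (rad W))" (is "?L = ?R")
proof -
  obtain v where v: "v \<in> W" "B v u \<noteq> 0" using u B_orth_commute by (auto simp: rad_def)
  have "rad W \<subseteq> ?L" "u \<in> ?L" using u B_orth_commute by (auto simp: rad_def perp_def)
  hence "?R \<subseteq> ?L" by (intro fn.span_minimal subspace_rad subspace_Int_perp W) auto
  moreover have "?L \<subseteq> ?R"
  proof
    fix x assume x: "x \<in> ?L"
    define a where "a = B x v / B u v"
    have uv: "B u v \<noteq> 0" using v B_orth_commute by blast
    define z where "z = x - vscale a u"
    have zL: "z \<in> ?L" unfolding z_def using x \<open>u \<in> ?L\<close>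
      by (intro fn.subspace_diff fn.subspace_scale subspace_rad subspace_Int_perp W)
    have zv: "B z v = 0" using uv by (simp add: z_def a_def B_simps)
    have "B z y = 0" if "y \<in> W" for y
    proof -
      have "y \<in> fn.span (insert v (W \<inter> perp u))" using that span_insert_perp[OF W v] by simp
      then obtain k where k: "y - vscale k v \<in> W \<inter> perp u"
        using subspace_Int_perp[OF W, of u] by (auto simp: fn.span_insert simp flip: fn.span_eq_iff)
      have "B z y = B z ((y - vscale k v) + vscale k v)" by simp
      also have "\<dots> = 0" unfolding B_add_right B_scale_right using zL k zv by (auto simp: rad_def)
      finally show ?thesis .
    qed
    hence "z \<in> rad W" using zL by (auto simp: rad_def)
    thus "x \<in> ?R" unfolding fn.span_insert z_def by (auto intro: fn.span_base)
  qed
  ultimately show "?L = ?R" by blast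
qed

text \<open>If every vector were isotropic, the norm of \<open>vscale a x + y\<close> would be the
  trace of \<open>a * B x y\<close>, which is nonzero for a suitable \<open>a\<close>. An
  anisotropic vector is then rescaled.\<close>

lemma exists_unit_vector:
  assumes W: "fn.subspace W" and ne: "rad W \<noteq> W"
  obtains w where "w \<in> W" "B w w = 1"
proof -
  have "\<exists>x\<in>W. B x x \<noteq> 0"
  proof (rule ccontr)
    assume "\<not> ?thesis"
    hence iso: "B x x = 0" if "x \<in> W" for x using that by blast
    obtain x y where xy: "x \<in> W" "y \<in> W" "B x y \<noteq> 0" using ne by (auto simp: rad_def)
    obtain t :: 'a where t: "t + t ^ q \<noteq> 0" using trace_nonzero by blast
    define a where "a = t / B x y"
    have "vscale a x + y \<in> W" using W xy by (simp add: fn.subspace_add fn.subspace_scale)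
    hence "B (vscale a x + y) (vscale a x + y) = 0" by (rule iso)
    hence "a * B x y + a ^ q * B y x = 0" using iso[OF xy(1)] iso[OF xy(2)] by (simp add: B_simps add.commute)
    moreover have "a ^ q * B y x = (a * B x y) ^ q" by (simp add: power_mult_distrib B_conj)
    ultimately show False using t xy by (simp add: a_def)
  qed
  then obtain x where x: "x \<in> W" "B x x \<noteq> 0" by blast
  \<comment> \<open>A norm \<open>B x x\<close> is fixed by conjugation, so its inverse is the norm
    of some scalar.\<close>
  have "inverse (B x x) ^ q = inverse (B x x)" using B_conj[of x x] by (simp add: power_inverse)
  then obtain a where a: "a ^ (q + 1) = inverse (B x x)" by (rule norm_surj)
  have "B (vscale a x) (vscale a x) = a ^ (q + 1) * B x x" by (simp add: B_simps)
  hence "B (vscale a x) (vscale a x) = 1" using a x by simp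
  thus ?thesis using that[of "vscale a x"] x W fn.subspace_scale by blast
qed

end

section \<open>Counting frames\<close>

lemma card_UN_Cons:
  assumes "finite A" "\<And>x. x \<in> A \<Longrightarrow> finite (F x) \<and> real (card (F x)) = N"
  shows "real (card (\<Union>x\<in>A. (#) x ` F x)) = real (card A) * N"
proof -
  have "card (\<Union>x\<in>A. (#) x ` F x) = (\<Sum>x\<in>A. card ((#) x ` F x))"
    using assms by (intro card_UN_disjoint) auto
  hence "real (card (\<Union>x\<in>A. (#) x ` F x)) = (\<Sum>x\<in>A. real (card (F x)))"
    by (simp add: card_image)
  thus ?thesis using assms(2) by simp
qed

context hermitian
begin

section \<open>Vectors of given norm\<close>

lemma card_Int_perp_power:
  assumes "fn.subspace W" "v \<in> W" "B v w \<noteq> 0" "card W = q ^ (2 * Suc m)"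
  shows "card (W \<inter> perp w) = q ^ (2 * m)"
proof -
  have "q\<^sup>2 * card (W \<inter> perp w) = q\<^sup>2 * q ^ (2 * m)"
    using card_Int_perp[OF assms(1-3)] assms(4) by (metis mult_Suc_right power_add)
  thus ?thesis using q_gt_1 by simp
qed

text \<open>Here \<open>d\<close> is the dimension of the radical and \<open>r\<close> the rank.
  Splitting off a unit vector \<open>w\<close> gives norm \<open>a ^ (q + 1) + B y y\<close> for
  \<open>vscale a w + y\<close>, so each \<open>y\<close> in the complement contributes one norm
  fibre, of size \<open>1\<close> or \<open>q + 1\<close>.\<close>

lemma card_norm_eq:
  assumes "finite W" "fn.subspace W" "card W = q ^ (2 * (d + r))" "card (rad W) = q ^ (2 * d)"
    and c: "c ^ q = c"
  shows "real (card {x \<in> W. B x x = c})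
    = real q ^ (2 * (d + r)) / real q * (1 + (if c = 0 then real q - 1 else - 1) * (- 1 / real q) ^ r)"
  using assms(1-4)
proof (induction r arbitrary: W)
  case 0
  hence "rad W = W" using card_subset_eq[OF \<open>finite W\<close> rad_subset] by simp
  hence "B x x = 0" if "x \<in> W" for x using that unfolding rad_def by blast
  hence "{x \<in> W. B x x = c} = (if c = 0 then W else {})" by auto
  thus ?case using 0 q_gt_1 by simp
next
  case (Suc r)
  have q: "real q > 0" using q_gt_1 by simp
  have "q ^ (2 * d) < q ^ (2 * (d + Suc r))" using q_gt_1 by (intro power_strict_increasing) auto
  hence "rad W \<noteq> W" using Suc.prems by auto
  then obtain w where w: "w \<in> W" "B w w = 1" using exists_unit_vector Suc.prems(2) by blast
  define W' where "W' = W \<inter> perp w"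
  have W': "fn.subspace W'" "finite W'" "w \<notin> W'"
    using Suc.prems w subspace_Int_perp by (auto simp: W'_def perp_def)
  have card: "card W' = q ^ (2 * (d + r))"
    unfolding W'_def using Suc.prems w by (intro card_Int_perp_power) auto
  define Z where "Z = card {x \<in> W'. B x x = c}"
  have "rad W' = rad W" unfolding W'_def using Suc.prems w by (intro rad_Int_perp_anisotropic) auto
  hence IH: "real Z
    = real q ^ (2 * (d + r)) / real q * (1 + (if c = 0 then real q - 1 else - 1) * (- 1 / real q) ^ r)"
    unfolding Z_def using Suc.IH[OF W'(2,1) card] Suc.prems by simp
  have W_eq: "fn.span (insert w W') = W"
    unfolding W'_def using Suc.prems w by (intro span_insert_perp) auto
  let ?f = "\<lambda>(y, a). vscale a w + y"
  have bij: "bij_betw (\<lambda>(a, y). vscale a w + y) (UNIV \<times> W') W"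
    using bij_betw_span_insert[OF W'(1,3)] W_eq by simp
  have norm: "B (vscale a w + y) (vscale a w + y) = a ^ (q + 1) + B y y" if "y \<in> W'" for a y
  proof -
    have "B y w = 0" "B w y = 0" using that B_orth_commute by (auto simp: W'_def perp_def)
    thus ?thesis using w by (simp add: B_simps)
  qed
  have inj: "inj_on ?f (SIGMA y:W'. {a. a ^ (q + 1) = c - B y y})"
  proof (rule inj_onI, clarify)
    fix a b y z assume "y \<in> W'" "z \<in> W'" "vscale a w + y = vscale b w + z"
    thus "y = z \<and> a = b" using inj_onD[OF bij_betw_imp_inj_on[OF bij], of "(a, y)" "(b, z)"] by simp
  qed
  have img: "?f ` (SIGMA y:W'. {a. a ^ (q + 1) = c - B y y}) = {x \<in> W. B x x = c}"
  proof (intro equalityI subsetI)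
    fix x assume "x \<in> ?f ` (SIGMA y:W'. {a. a ^ (q + 1) = c - B y y})"
    then obtain a y where "y \<in> W'" "a ^ (q + 1) = c - B y y" "x = vscale a w + y" by auto
    moreover from this have "x \<in> W"
      using Suc.prems(2) w(1) by (simp add: W'_def fn.subspace_add fn.subspace_scale)
    ultimately show "x \<in> {x \<in> W. B x x = c}" using norm by simp
  next
    fix x assume x: "x \<in> {x \<in> W. B x x = c}"
    hence "x \<in> (\<lambda>(a, y). vscale a w + y) ` (UNIV \<times> W')"
      using bij_betw_imp_surj_on[OF bij] by simp
    then obtain a y where y: "y \<in> W'" "x = vscale a w + y" by auto
    hence "a ^ (q + 1) = c - B y y" using x norm by (simp add: algebra_simps)
    thus "x \<in> ?f ` (SIGMA y:W'. {a. a ^ (q + 1) = c - B y y})" using y by force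
  qed
  have fibre: "card {a. a ^ (q + 1) = c - B y y} = (if B y y = c then 1 else q + 1)" for y
  proof (cases "B y y = c")
    case False
    moreover have "(c - B y y) ^ q = c - B y y" using c by (simp add: conj_diff B_conj)
    ultimately show ?thesis using card_norm_fibre[of "c - B y y"] by simp
  next
    case True
    have "{a :: 'a. a ^ (q + 1) = 0} = {0}" by auto
    with True show ?thesis by simp
  qed
  have "card {x \<in> W. B x x = c} = (\<Sum>y\<in>W'. card {a. a ^ (q + 1) = c - B y y})"
    using card_image[OF inj] img W'(2) by simp
  also have "\<dots> = (\<Sum>y\<in>W'. if B y y = c then 1 else q + 1)" by (simp only: fibre)
  also have "\<dots> = Z + (q + 1) * card {y \<in> W'. B y y \<noteq> c}"
    using W'(2) by (simp add: sum.If_cases Z_def Int_def)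
  also have "card {y \<in> W'. B y y \<noteq> c} = card W' - Z"
  proof -
    have "{y \<in> W'. B y y \<noteq> c} = W' - {x \<in> W'. B x x = c}" by auto
    thus ?thesis using W'(2) by (simp add: Z_def card_Diff_subset)
  qed
  finally have *: "card {x \<in> W. B x x = c} = Z + (q + 1) * (card W' - Z)" .
  have "Z \<le> card W'" unfolding Z_def by (rule card_mono) (use W' in auto)
  hence "real (card W' - Z) = real q ^ (2 * (d + r)) - real Z" by (simp only: of_nat_diff card of_nat_power)
  \<comment> \<open>The recursion in the rank: the coefficient \<open>- q\<close> of
    \<open>Z\<close>, set against the growth factor \<open>q ^ 2\<close> of the leading term,
    produces the powers of \<open>- 1 / q\<close>.\<close>
  hence "real (card {x \<in> W. B x x = c}) = (real q + 1) * real q ^ (2 * (d + r)) - real q * real Z"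
    unfolding * of_nat_add of_nat_mult by (simp only: of_nat_1) (simp add: algebra_simps)
  also have "\<dots> = real q ^ (2 * (d + Suc r)) / real q
      * (1 + (if c = 0 then real q - 1 else - 1) * (- 1 / real q) ^ Suc r)"
    unfolding IH using q by (simp add: field_simps power2_eq_square)
  finally show ?case .
qed

text \<open>
  The set \<open>U\<close> contains the vectors from which the next one has to be independent; it may be smaller
  than the radical of \<open>W\<close>, so that the same definition counts bases of a totally isotropic space.
\<close>

primrec iso_frames :: "nat \<Rightarrow> (nat \<Rightarrow> 'a) set \<Rightarrow> (nat \<Rightarrow> 'a) set \<Rightarrow> (nat \<Rightarrow> 'a) list set" where
  "iso_frames 0 U W = {[]}"
| "iso_frames (Suc l) U W =
    (\<Union>x\<in>{x \<in> W - U. B x x = 0}. (#) x ` iso_frames l (fn.span (insert x U)) (W \<inter> perp x))"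

text \<open>The isotropic part starts from \<open>{0}\<close>. This is the radical of the whole
  space, but not of a code with nonzero hull, where the last \<open>l\<close> entries have to form a
  basis of that hull.\<close>

primrec frames :: "nat \<Rightarrow> nat \<Rightarrow> (nat \<Rightarrow> 'a) set \<Rightarrow> (nat \<Rightarrow> 'a) list set" where
  "frames 0 l W = iso_frames l {0} W"
| "frames (Suc j) l W = (\<Union>x\<in>{x \<in> W. B x x = 1}. (#) x ` frames j l (W \<inter> perp x))"

section \<open>Restriction and enumeration of frames\<close>

lemma iso_frames_subset: "xs \<in> iso_frames l U W \<Longrightarrow> set xs \<subseteq> W"
  by (induction l arbitrary: U W xs) fastforce+

lemma frames_subset: "xs \<in> frames j l W \<Longrightarrow> set xs \<subseteq> W"
  by (induction j arbitrary: W xs) (use iso_frames_subset in fastforce)+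

text \<open>Apart from membership in \<open>W\<close>, the conditions on an entry involve only the
  entry, the earlier ones and \<open>U\<close>. This will identify the frames of a code with the
  frames of the whole space contained in it.\<close>

lemma iso_frames_restrict:
  "W' \<subseteq> W \<Longrightarrow> iso_frames l U W' = {xs \<in> iso_frames l U W. set xs \<subseteq> W'}"
proof (induction l arbitrary: U W W')
  case (Suc l)
  have "iso_frames l (fn.span (insert x U)) (W' \<inter> perp x) =
      {xs \<in> iso_frames l (fn.span (insert x U)) (W \<inter> perp x). set xs \<subseteq> W'}" for x
    using Suc.IH[OF Int_mono[OF Suc.prems subset_refl], of "fn.span (insert x U)" "perp x"]
      iso_frames_subset[of _ l "fn.span (insert x U)" "W \<inter> perp x"] by auto
  thus ?case using Suc.prems by auto
qed auto

lemma frames_restrict: "W' \<subseteq> W \<Longrightarrow> frames j l W' = {xs \<in> frames j l W. set xs \<subseteq> W'}"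
proof (induction j arbitrary: W W')
  case (Suc j)
  have "frames j l (W' \<inter> perp x) = {xs \<in> frames j l (W \<inter> perp x). set xs \<subseteq> W'}" for x
    using Suc.IH[OF Int_mono[OF Suc.prems subset_refl], of "perp x"]
      frames_subset[of _ j l "W \<inter> perp x"] by auto
  thus ?case using Suc.prems by auto
qed (simp add: iso_frames_restrict)

lemma finite_iso_frames: "finite W \<Longrightarrow> finite (iso_frames l U W)"
  by (induction l arbitrary: U W) auto

lemma finite_frames: "finite W \<Longrightarrow> finite (frames j l W)"
  by (induction j arbitrary: W) (auto simp: finite_iso_frames)

text \<open>An isotropic vector outside the radical joins the radical of its complement. So each
  choice raises \<open>d\<close> by one, lowers the rank by two, and keeps the excluded set equal to
  the radical; the factors come from \<open>card_norm_eq\<close> at norm \<open>0\<close>.\<close>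

lemma card_iso_frames:
  assumes "finite W" "fn.subspace W" "card W = q ^ (2 * (d + (2 * l + s)))"
    "card (rad W) = q ^ (2 * d)"
  shows "real (card (iso_frames l (rad W) W)) =
    (\<Prod>i<l. real q ^ (2 * (d + i + (2 * (l - i) + s))) / real q
        * (1 + (real q - 1) * (- 1 / real q) ^ (2 * (l - i) + s)) - real q ^ (2 * (d + i)))"
  using assms
proof (induction l arbitrary: d W)
  case (Suc l)
  let ?A = "{x \<in> W - rad W. B x x = 0}"
  let ?N = "\<lambda>l d. \<Prod>i<l. real q ^ (2 * (d + i + (2 * (l - i) + s))) / real q
        * (1 + (real q - 1) * (- 1 / real q) ^ (2 * (l - i) + s)) - real q ^ (2 * (d + i))"
  have A: "?A = {x \<in> W. B x x = 0} - rad W" by auto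
  have sub: "rad W \<subseteq> {x \<in> W. B x x = 0}" by (auto simp: rad_def)
  have fin: "finite {x \<in> W. B x x = 0}" using Suc.prems by simp
  have "real (card ?A) = real (card {x \<in> W. B x x = 0}) - real (card (rad W))"
    unfolding A using sub fin card_mono[OF fin sub] finite_subset[OF sub fin]
    by (simp add: card_Diff_subset of_nat_diff)
  also have "\<dots> = real q ^ (2 * (d + (2 * Suc l + s))) / real q
      * (1 + (real q - 1) * (- 1 / real q) ^ (2 * Suc l + s)) - real q ^ (2 * d)"
    using card_norm_eq[OF Suc.prems, of 0] Suc.prems(4) by simp
  finally have cA: "real (card ?A) = \<dots>" .
  have step: "finite (iso_frames l (fn.span (insert x (rad W))) (W \<inter> perp x)) \<and>
      real (card (iso_frames l (fn.span (insert x (rad W))) (W \<inter> perp x))) = ?N l (Suc d)"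
    if x: "x \<in> ?A" for x
  proof -
    have rad: "rad (W \<inter> perp x) = fn.span (insert x (rad W))"
      using rad_Int_perp_isotropic[of W x] x Suc.prems by auto
    obtain v where "v \<in> W" "B v x \<noteq> 0" using x B_orth_commute by (auto simp: rad_def)
    hence "card (W \<inter> perp x) = q ^ (2 * (Suc d + (2 * l + s)))"
      using Suc.prems by (intro card_Int_perp_power) auto
    moreover have "card (rad (W \<inter> perp x)) = q ^ (2 * Suc d)"
      unfolding rad using card_span_insert[OF subspace_rad, of W x] x Suc.prems CARD
      by (simp add: power2_eq_square)
    ultimately show ?thesis
      using Suc.IH[of "W \<inter> perp x" "Suc d"] Suc.prems subspace_Int_perp finite_iso_frames
      by (simp add: rad)
  qed
  have "real (card (iso_frames (Suc l) (rad W) W)) = real (card ?A) * ?N l (Suc d)"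
    unfolding iso_frames.simps using Suc.prems(1) step by (intro card_UN_Cons) auto
  also have "\<dots> = ?N (Suc l) d"
    unfolding cA by (subst prod.lessThan_Suc_shift) simp
  finally show ?case .
qed simp

text \<open>All vectors are mutually orthogonal, so passing to complements never shrinks
  \<open>W\<close> and only independence from \<open>U\<close> restricts the choice.\<close>

lemma card_iso_frames_totally_isotropic:
  assumes "finite W" "rad W = W" "card W = q ^ (2 * m)"
    "fn.subspace U" "U \<subseteq> W" "card U = q ^ (2 * d)" "fn.subspace W"
  shows "real (card (iso_frames l U W)) = (\<Prod>i<l. real q ^ (2 * m) - real q ^ (2 * (d + i)))"
  using assms(4-6)
proof (induction l arbitrary: d U)
  case (Suc l)
  have iso: "B x y = 0" if "x \<in> W" "y \<in> W" for x y
    using that assms(2) unfolding rad_def by blast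
  hence A: "{x \<in> W - U. B x x = 0} = W - U" by auto
  have fin: "finite U" using Suc.prems assms(1) finite_subset by blast
  have "real (card (W - U)) = real (card W) - real (card U)"
    using card_mono[OF assms(1) Suc.prems(2)] Suc.prems fin by (simp add: card_Diff_subset of_nat_diff)
  hence cA: "real (card (W - U)) = real q ^ (2 * m) - real q ^ (2 * d)"
    using assms Suc.prems by simp
  have step: "finite (iso_frames l (fn.span (insert x U)) (W \<inter> perp x)) \<and>
      real (card (iso_frames l (fn.span (insert x U)) (W \<inter> perp x)))
        = (\<Prod>i<l. real q ^ (2 * m) - real q ^ (2 * (Suc d + i)))" if x: "x \<in> W - U" for x
  proof -
    have "W \<inter> perp x = W" using iso x by (auto simp: perp_def)
    moreover have "fn.span (insert x U) \<subseteq> W"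
      using x Suc.prems assms by (intro fn.span_minimal) auto
    moreover have "card (fn.span (insert x U)) = q ^ (2 * Suc d)"
      using card_span_insert[of U x] x Suc.prems CARD by (simp add: power2_eq_square)
    ultimately show ?thesis
      using Suc.IH[of "fn.span (insert x U)" "Suc d"] finite_iso_frames assms(1) by simp
  qed
  have "real (card (iso_frames (Suc l) U W))
      = real (card (W - U)) * (\<Prod>i<l. real q ^ (2 * m) - real q ^ (2 * (Suc d + i)))"
    unfolding iso_frames.simps A using assms(1) step by (intro card_UN_Cons) auto
  also have "\<dots> = (\<Prod>i<Suc l. real q ^ (2 * m) - real q ^ (2 * (d + i)))"
    unfolding cA by (subst prod.lessThan_Suc_shift) simp
  finally show ?case .
qed simp

text \<open>Each unit vector lowers the rank by one and keeps the radical. The count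
  \<open>N\<close> for the remaining space of rank \<open>r\<close> is left abstract, since it is
  obtained differently for a code and for the whole space.\<close>

lemma card_frames:
  assumes "finite W" "fn.subspace W" "card W = q ^ (2 * (d + (j + r)))" "card (rad W) = q ^ (2 * d)"
    and N: "\<And>V. V \<subseteq> W \<Longrightarrow> fn.subspace V \<Longrightarrow> card V = q ^ (2 * (d + r)) \<Longrightarrow> rad V = rad W \<Longrightarrow>
      real (card (iso_frames l {0} V)) = N"
  shows "real (card (frames j l W)) =
    (\<Prod>i<j. real q ^ (2 * (d + (j - i + r))) / real q * (1 - (- 1 / real q) ^ (j - i + r))) * N"
  using assms
proof (induction j arbitrary: W)
  case (Suc j)
  let ?A = "{x \<in> W. B x x = 1}"
  let ?P = "\<lambda>j. \<Prod>i<j. real q ^ (2 * (d + (j - i + r))) / real q * (1 - (- 1 / real q) ^ (j - i + r))"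
  have cA: "real (card ?A) = real q ^ (2 * (d + (Suc j + r))) / real q * (1 - (- 1 / real q) ^ (Suc j + r))"
    using card_norm_eq[OF Suc.prems(1-4), of 1] by simp
  have step: "finite (frames j l (W \<inter> perp x)) \<and> real (card (frames j l (W \<inter> perp x))) = ?P j * N"
    if x: "x \<in> ?A" for x
  proof -
    have "card (W \<inter> perp x) = q ^ (2 * (d + (j + r)))"
      using x Suc.prems by (intro card_Int_perp_power) auto
    moreover have "rad (W \<inter> perp x) = rad W"
      using rad_Int_perp_anisotropic[of W x] x Suc.prems by simp
    ultimately show ?thesis
      using Suc.IH[of "W \<inter> perp x"] Suc.prems subspace_Int_perp finite_frames
      by (simp add: le_infI1)
  qed
  have "real (card (frames (Suc j) l W)) = real (card ?A) * (?P j * N)"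
    unfolding frames.simps using Suc.prems(1) step by (intro card_UN_Cons) auto
  also have "\<dots> = ?P (Suc j) * N"
    unfolding cA by (subst prod.lessThan_Suc_shift) simp
  finally show ?case .
qed simp

section \<open>Spans of frames and the double count\<close>

lemma span_span_Un: "fn.span (fn.span A \<union> C) = fn.span (A \<union> C)"
  by (meson antisym fn.span_minimal fn.span_mono fn.span_superset fn.subspace_span le_sup_iff
      order_trans sup_ge1 sup_ge2)

text \<open>Each entry lies outside the span built so far, which contributes a factor
  \<open>q ^ 2\<close>, and the later entries are drawn from the complements of the earlier
  ones.\<close>

lemma iso_frames_span:
  assumes "xs \<in> iso_frames l U W" "fn.subspace U"
  shows "card (fn.span (U \<union> set xs)) = q ^ (2 * l) * card U"
    and "\<forall>x\<in>set xs. \<forall>y\<in>set xs. B x y = 0"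
  using assms
proof (induction l arbitrary: U W xs)
  case (Suc l)
  {
    case 1
    then obtain x ys where x: "xs = x # ys" "x \<notin> U"
      and ys: "ys \<in> iso_frames l (fn.span (insert x U)) (W \<inter> perp x)" by auto
    have "fn.span (U \<union> set xs) = fn.span (fn.span (insert x U) \<union> set ys)"
      by (simp add: x span_span_Un)
    also have "card \<dots> = q ^ (2 * l) * card (fn.span (insert x U))"
      using Suc.IH(1)[OF ys] by simp
    finally show ?case using card_span_insert[of U x] x 1 CARD by (simp add: power2_eq_square)
  next
    case 2
    then obtain x ys where x: "xs = x # ys" "B x x = 0"
      and ys: "ys \<in> iso_frames l (fn.span (insert x U)) (W \<inter> perp x)" by auto
    show ?case
      using Suc.IH(2)[OF ys] iso_frames_subset[OF ys] x B_orth_commute by (auto simp: perp_def)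
  }
qed (simp_all add: fn.span_eq_iff[THEN iffD2])

lemma rad_span_totally_isotropic:
  assumes "\<forall>x\<in>A. \<forall>y\<in>A. B x y = 0"
  shows "rad (fn.span A) = fn.span A"
proof -
  have 1: "fn.span A \<subseteq> perp y" if "y \<in> A" for y
    using that assms by (intro fn.span_minimal subspace_perp) (auto simp: perp_def)
  have "fn.span A \<subseteq> perp x" if "x \<in> fn.span A" for x
    using that 1 B_orth_commute by (intro fn.span_minimal subspace_perp) (auto simp: perp_def)
  thus ?thesis using B_orth_commute by (auto simp: rad_def perp_def)
qed

text \<open>The isotropic entries span a totally isotropic space. A unit vector put in front is
  orthogonal to the span of the rest, so it adds one dimension and leaves the radical
  unchanged.\<close>

lemma frames_span:
  assumes "xs \<in> frames j l W"
  shows "card (fn.span (set xs)) = q ^ (2 * (j + l)) \<and> card (rad (fn.span (set xs))) = q ^ (2 * l)"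
  using assms
proof (induction j arbitrary: W xs)
  case 0
  hence xs: "xs \<in> iso_frames l {0} W" by simp
  have "card (fn.span (set xs)) = q ^ (2 * l)" using iso_frames_span(1)[OF xs] by simp
  thus ?case using rad_span_totally_isotropic iso_frames_span(2)[OF xs] by simp
next
  case (Suc j)
  then obtain x ys where x: "xs = x # ys" "B x x = 1" and ys: "ys \<in> frames j l (W \<inter> perp x)" by auto
  let ?S = "fn.span (set xs)" and ?T = "fn.span (set ys)"
  have S: "?S = fn.span (insert x ?T)" by (simp add: x fn.span_insert fn.span_span)
  have T: "?T \<subseteq> perp x"
    using frames_subset[OF ys] by (intro fn.span_minimal subspace_perp) auto
  have "?S \<inter> perp x = ?T"
  proof (intro equalityI subsetI)
    fix y assume y: "y \<in> ?S \<inter> perp x"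
    then obtain k where k: "y - vscale k x \<in> ?T" by (auto simp: x fn.span_insert)
    hence "B y x - k * B x x = 0" using T by (auto simp: perp_def B_simps)
    hence "k = 0" using x y by (simp add: perp_def)
    thus "y \<in> ?T" using k by simp
  qed (use T x fn.span_mono[of "set ys" "set xs"] in auto)
  moreover have "x \<in> ?S" using x by (simp add: fn.span_base)
  ultimately have "rad ?S = rad ?T"
    using rad_Int_perp_anisotropic[of ?S x] x by simp
  moreover have "x \<notin> ?T" using T x by (auto simp: perp_def)
  hence "card ?S = q\<^sup>2 * card ?T" unfolding S using CARD by (simp add: card_span_insert)
  ultimately show ?case using Suc.IH[OF ys] by (simp add: power2_eq_square power_add)
qed

lemma HHull_iff:
  "C \<in> HHull q n k l \<longleftrightarrow> C \<subseteq> vecs n \<and> fn.subspace C \<and> card C = q ^ (2 * k) \<and> card (rad C) = q ^ (2 * l)"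
proof (cases "C \<subseteq> vecs n \<and> fn.subspace C")
  case True
  hence fin: "finite C" "finite (rad C)" using finite_vecs rad_subset finite_subset by metis+
  thus ?thesis
    using True dim_eq_iff_card[OF fin(1), of k] dim_eq_iff_card[OF fin(2) subspace_rad, of l] CARD
    by (simp add: HHull_def linear_codes_def herm_hull_eq_rad power_mult)
qed (auto simp: HHull_def linear_codes_def)

lemma finite_HHull: "finite (HHull q n k l :: (nat \<Rightarrow> 'a) set set)"
  by (rule finite_subset[of _ "Pow (vecs n)"]) (auto simp: HHull_iff finite_vecs)

text \<open>A frame of the whole space is a frame of its own span, and that span is a code with a
  hull of dimension \<open>l\<close>.\<close>

lemma frames_vecs: "frames j l (vecs n) = (\<Union>C\<in>HHull q n (j + l) l. frames j l C)"
proof (intro equalityI subsetI)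
  fix xs assume xs: "xs \<in> frames j l (vecs n)"
  let ?C = "fn.span (set xs)"
  have C: "?C \<subseteq> vecs n" using frames_subset[OF xs] subspace_vecs by (intro fn.span_minimal) auto
  hence "?C \<in> HHull q n (j + l) l" using frames_span[OF xs] by (simp add: HHull_iff)
  moreover have "xs \<in> frames j l ?C"
    using frames_restrict[OF C] xs fn.span_superset by blast
  ultimately show "xs \<in> (\<Union>C\<in>HHull q n (j + l) l. frames j l C)" by blast
next
  fix xs assume "xs \<in> (\<Union>C\<in>HHull q n (j + l) l. frames j l C)"
  then obtain C where C: "C \<subseteq> vecs n" "xs \<in> frames j l C" by (auto simp: HHull_iff)
  show "xs \<in> frames j l (vecs n)" using C(2) frames_restrict[OF C(1)] by simp
qed

text \<open>The span of the frame has as many elements as the code containing it. Hence different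
  codes have no frame in common.\<close>

lemma frames_HHull_unique:
  assumes "C \<in> HHull q n (j + l) l" "xs \<in> frames j l C"
  shows "C = fn.span (set xs)"
proof -
  have C: "finite C" "fn.subspace C" "card C = q ^ (2 * (j + l))"
    using assms finite_vecs finite_subset unfolding HHull_iff by blast+
  have "fn.span (set xs) \<subseteq> C"
    using frames_subset[OF assms(2)] C by (intro fn.span_minimal) auto
  thus ?thesis using card_subset_eq[OF C(1)] C frames_span[OF assms(2)] by metis
qed

text \<open>The double count for dimension \<open>k = j + l\<close>, with
  \<open>s = n - k - l\<close>; the range \<open>l \<le> k \<le> n - l\<close> is what makes
  \<open>j\<close> and \<open>s\<close> natural numbers. The factor on the left counts the frames of
  one code, the right-hand side those of the whole space.\<close>

lemma card_HHull:
  assumes n: "n = j + (2 * l + s)"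
  shows "real (card (HHull q n (j + l) l :: (nat \<Rightarrow> 'a) set set))
      * ((\<Prod>i<j. real q ^ (2 * (l + (j - i))) / real q * (1 - (- 1 / real q) ^ (j - i)))
          * (\<Prod>i<l. real q ^ (2 * l) - real q ^ (2 * i)))
    = (\<Prod>i<j. real q ^ (2 * (j - i + (2 * l + s))) / real q * (1 - (- 1 / real q) ^ (j - i + (2 * l + s))))
        * (\<Prod>i<l. real q ^ (2 * (i + (2 * (l - i) + s))) / real q
            * (1 + (real q - 1) * (- 1 / real q) ^ (2 * (l - i) + s)) - real q ^ (2 * i))"
    (is "_ * ?c = ?v")
proof -
  have zero: "card {0 :: nat \<Rightarrow> 'a} = q ^ (2 * 0)" by simp
  have code: "real (card (frames j l C)) = ?c" if "C \<in> HHull q n (j + l) l" for C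
  proof -
    have C: "finite C" "fn.subspace C" "card C = q ^ (2 * (l + (j + 0)))" "card (rad C) = q ^ (2 * l)"
      using that finite_subset[OF _ finite_vecs, of C n] by (simp_all add: HHull_iff add.commute)
    \<comment> \<open>After the unit vectors, a code leaves a space of rank \<open>0\<close>, which
      is its own radical.\<close>
    have "real (card (iso_frames l {0} V)) = (\<Prod>i<l. real q ^ (2 * l) - real q ^ (2 * (0 + i)))"
      if V: "V \<subseteq> C" "fn.subspace V" "card V = q ^ (2 * (l + 0))" "rad V = rad C" for V
    proof (rule card_iso_frames_totally_isotropic[OF _ _ _ _ _ zero])
      show "finite V" using V(1) C(1) finite_subset by blast
      thus "rad V = V" using card_subset_eq[OF _ rad_subset, of V] V C by simp
    qed (use V(2,3) fn.subspace_0[OF V(2)] fn.subspace_single_0 in simp_all)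
    note card_frames[OF C this]
    thus ?thesis by (simp only: add_0 add_0_right)
  qed
  have V: "card (vecs n :: (nat \<Rightarrow> 'a) set) = q ^ (2 * (0 + (j + (2 * l + s))))"
    "card (rad (vecs n)) = q ^ (2 * 0)"
    by (simp_all only: card_vecs CARD power_mult add_0 rad_vecs zero flip: n)
  \<comment> \<open>In the whole space the radical is \<open>{0}\<close>, so the excluded set
    \<open>{0}\<close> is the radical of the remaining space.\<close>
  have "real (card (iso_frames l {0} V)) = (\<Prod>i<l. real q ^ (2 * (0 + i + (2 * (l - i) + s))) / real q
            * (1 + (real q - 1) * (- 1 / real q) ^ (2 * (l - i) + s)) - real q ^ (2 * (0 + i)))"
    if V: "V \<subseteq> vecs n" "fn.subspace V" "card V = q ^ (2 * (0 + (2 * l + s)))" "rad V = rad (vecs n)" for V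
    using card_iso_frames[OF finite_subset[OF V(1) finite_vecs] V(2,3)] V(4) by (simp add: rad_vecs)
  note card_frames[OF finite_vecs subspace_vecs V this]
  hence "?v = real (card (frames j l (vecs n)))" by (simp only: add_0)
  also have "card (frames j l (vecs n)) = (\<Sum>C\<in>HHull q n (j + l) l. card (frames j l C))"
    unfolding frames_vecs
  proof (rule card_UN_disjoint)
    show "\<forall>C\<in>HHull q n (j + l) l. finite (frames j l C)"
    proof (intro ballI finite_frames)
      fix C :: "(nat \<Rightarrow> 'a) set" assume "C \<in> HHull q n (j + l) l"
      thus "finite C" using finite_subset[OF _ finite_vecs, of C n] by (simp add: HHull_iff)
    qed
    show "\<forall>C\<in>HHull q n (j + l) l. \<forall>D\<in>HHull q n (j + l) l. C \<noteq> D \<longrightarrow> frames j l C \<inter> frames j l D = {}"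
      using frames_HHull_unique by blast
  qed (rule finite_HHull)
  also have "real \<dots> = real (card (HHull q n (j + l) l :: (nat \<Rightarrow> 'a) set set)) * ?c"
    using code by simp
  finally show ?thesis by simp
qed

end

section \<open>The limit\<close>

text \<open>The Pochhammer symbol \<open>(x; x)_m\<close>. At \<open>x = 1 / Q\<close> it is
  \<open>g_fin Q m\<close>; the frame counts bring in the negative argument
  \<open>- 1 / q\<close>.\<close>

definition euler_prod :: "real \<Rightarrow> nat \<Rightarrow> real" where
  "euler_prod x m = (\<Prod>i=1..m. (1 - x ^ i))"

lemma euler_prod_0 [simp]: "euler_prod x 0 = 1"
  by (simp add: euler_prod_def)

lemma euler_prod_Suc [simp]: "euler_prod x (Suc m) = euler_prod x m * (1 - x ^ Suc m)"
  by (simp add: euler_prod_def)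

lemma g_fin_eq_euler_prod: "g_fin Q = euler_prod (1 / Q)"
  by (simp add: g_fin_def euler_prod_def fun_eq_iff power_one_over)

lemma abs_power_Suc_less_one:
  fixes x :: real
  assumes "\<bar>x\<bar> < 1"
  shows "\<bar>x ^ Suc m\<bar> < 1"
proof -
  have "\<bar>x\<bar> * \<bar>x\<bar> ^ m \<le> \<bar>x\<bar>" using assms by (intro mult_left_le power_le_one) auto
  thus ?thesis using assms by (simp add: abs_mult power_abs)
qed

lemma euler_prod_factor_nonzero: "\<bar>x\<bar> < 1 \<Longrightarrow> 1 - x ^ Suc m \<noteq> (0 :: real)"
  using abs_power_Suc_less_one[of x m] by linarith

lemma euler_prod_nonzero: "\<bar>x\<bar> < 1 \<Longrightarrow> euler_prod x m \<noteq> 0"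
  using euler_prod_factor_nonzero by (induction m) auto

text \<open>The geometric series makes the product absolutely convergent, and no factor vanishes, so
  the limit is nonzero.\<close>

lemma euler_prod_convergent:
  assumes "\<bar>x\<bar> < 1"
  shows "euler_prod x \<longlonglongrightarrow> lim (euler_prod x)" "lim (euler_prod x) \<noteq> 0"
proof -
  let ?f = "\<lambda>i. 1 - x ^ Suc i"
  have "summable (\<lambda>i. norm (?f i - 1))"
    using assms by (simp add: abs_mult power_abs summable_mult summable_geometric)
  hence "convergent_prod ?f"
    by (simp only: abs_convergent_prod_conv_summable[symmetric] abs_convergent_prod_imp_convergent_prod)
  then obtain L where L: "(\<lambda>n. \<Prod>i\<le>n. ?f i) \<longlonglongrightarrow> L" "L \<noteq> 0"
    using convergent_prod_iff_nz_lim[of ?f] euler_prod_factor_nonzero[OF assms] by blast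
  have "(\<lambda>n. \<Prod>i\<le>n. ?f i) = (\<lambda>n. euler_prod x (Suc n))"
  proof
    show "(\<Prod>i\<le>n. ?f i) = euler_prod x (Suc n)" for n by (induction n) auto
  qed
  hence "euler_prod x \<longlonglongrightarrow> L" using L(1) by (simp only: filterlim_sequentially_Suc)
  thus "euler_prod x \<longlonglongrightarrow> lim (euler_prod x)" "lim (euler_prod x) \<noteq> 0"
    using L(2) limI by blast+
qed

lemma euler_prod_shift:
  "euler_prod x c * (\<Prod>i<j. 1 - x ^ (j - i + c)) = euler_prod x (j + c)"
  by (induction j) (simp_all add: prod.lessThan_Suc_shift mult_ac del: prod.lessThan_Suc)

text \<open>For odd \<open>i\<close> the factors \<open>1 + y ^ i\<close> and
  \<open>1 - y ^ i\<close> combine to \<open>1 - (y ^ 2) ^ i\<close>, and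
  \<open>euler_prod (y ^ 4) r\<close> supplies the even exponents of \<open>y ^ 2\<close>. The
  factors with even \<open>i\<close> agree in the first two products and give the square.\<close>

lemma euler_prod_minus:
  "euler_prod (- y) (2 * r) * euler_prod y (2 * r) * euler_prod (y ^ 4) r
    = euler_prod (y\<^sup>2) (2 * r) * (euler_prod (y\<^sup>2) r)\<^sup>2"
proof (induction r)
  case (Suc r)
  \<comment> \<open>With \<open>t\<close> the new factors are polynomials in \<open>y\<close> and
    \<open>t\<close>, so that their equality is a polynomial identity.\<close>
  define t where "t = y ^ r"
  have "(- y) ^ (2 * r) = y ^ (2 * r)" by simp
  hence "(- y) ^ Suc (2 * r) = - (y * t\<^sup>2)" "(- y) ^ Suc (Suc (2 * r)) = y\<^sup>2 * t\<^sup>2"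
    "y ^ Suc (2 * r) = y * t\<^sup>2" "y ^ Suc (Suc (2 * r)) = y\<^sup>2 * t\<^sup>2" "(y ^ 4) ^ Suc r = y ^ 4 * t ^ 4"
    "(y\<^sup>2) ^ Suc (2 * r) = y\<^sup>2 * t ^ 4" "(y\<^sup>2) ^ Suc (Suc (2 * r)) = y ^ 4 * t ^ 4" "(y\<^sup>2) ^ Suc r = y\<^sup>2 * t\<^sup>2"
    by (simp_all only: power_Suc)
       (simp_all add: t_def mult_2 power_add power_mult_distrib power2_eq_square power4_eq_xxxx)
  hence L: "euler_prod (- y) (2 * Suc r) * euler_prod y (2 * Suc r) * euler_prod (y ^ 4) (Suc r)
    = (euler_prod (- y) (2 * r) * euler_prod y (2 * r) * euler_prod (y ^ 4) r)
       * ((1 + y * t\<^sup>2) * (1 - y\<^sup>2 * t\<^sup>2) * (1 - y * t\<^sup>2) * (1 - y\<^sup>2 * t\<^sup>2) * (1 - y ^ 4 * t ^ 4))"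
    and R: "euler_prod (y\<^sup>2) (2 * Suc r) * (euler_prod (y\<^sup>2) (Suc r))\<^sup>2
    = (euler_prod (y\<^sup>2) (2 * r) * (euler_prod (y\<^sup>2) r)\<^sup>2)
       * ((1 - y\<^sup>2 * t ^ 4) * (1 - y ^ 4 * t ^ 4) * (1 - y\<^sup>2 * t\<^sup>2)\<^sup>2)"
    by (simp_all only: mult_Suc_right add_2_eq_Suc euler_prod_Suc) (simp_all add: power2_eq_square mult_ac)
  have E: "(1 + y * t\<^sup>2) * (1 - y\<^sup>2 * t\<^sup>2) * (1 - y * t\<^sup>2) * (1 - y\<^sup>2 * t\<^sup>2) * (1 - y ^ 4 * t ^ 4)
      = (1 - y\<^sup>2 * t ^ 4) * (1 - y ^ 4 * t ^ 4) * (1 - y\<^sup>2 * t\<^sup>2)\<^sup>2"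
    by algebra
  show ?case by (simp only: L R E Suc.IH)
qed simp

lemma euler_prod_minus_lim:
  assumes "\<bar>y\<bar> < 1"
  shows "lim (euler_prod (- y)) * lim (euler_prod y) * lim (euler_prod (y ^ 4)) = lim (euler_prod (y\<^sup>2)) ^ 3"
proof -
  have y: "\<bar>- y\<bar> < 1" "\<bar>y ^ 4\<bar> < 1" "\<bar>y\<^sup>2\<bar> < 1"
    using abs_power_Suc_less_one[OF assms, of 3] abs_power_Suc_less_one[OF assms, of 1] assms
    by (simp_all add: eval_nat_numeral)
  note lim = assms[THEN euler_prod_convergent(1)] y[THEN euler_prod_convergent(1)]
  \<comment> \<open>The finite identity is stated for even lengths, so the limit is taken along even
    indices.\<close>
  have two: "filterlim (\<lambda>r::nat. 2 * r) at_top at_top"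
    by (rule filterlim_subseq) (simp add: strict_mono_def)
  note lim2 = lim[THEN filterlim_compose, OF two]
  have "(\<lambda>r. euler_prod (- y) (2 * r) * euler_prod y (2 * r) * euler_prod (y ^ 4) r)
      \<longlonglongrightarrow> lim (euler_prod (- y)) * lim (euler_prod y) * lim (euler_prod (y ^ 4))"
    by (intro tendsto_mult lim lim2)
  moreover have "(\<lambda>r. euler_prod (- y) (2 * r) * euler_prod y (2 * r) * euler_prod (y ^ 4) r)
      \<longlonglongrightarrow> lim (euler_prod (y\<^sup>2)) * (lim (euler_prod (y\<^sup>2)))\<^sup>2"
    unfolding euler_prod_minus by (intro tendsto_mult tendsto_power lim lim2)
  ultimately have "lim (euler_prod (- y)) * lim (euler_prod y) * lim (euler_prod (y ^ 4))
      = lim (euler_prod (y\<^sup>2)) * (lim (euler_prod (y\<^sup>2)))\<^sup>2"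
    by (rule LIMSEQ_unique)
  thus ?thesis by (simp only: power3_eq_cube power2_eq_square mult.assoc)
qed

section \<open>Gaussian binomials and the exact quotient\<close>

lemma prod_diff_power_eq_euler_prod:
  fixes Q :: real
  assumes "Q > 1"
  shows "(\<Prod>i<k. Q ^ (a + k) - Q ^ i) * euler_prod (1 / Q) a = Q ^ ((a + k) * k) * euler_prod (1 / Q) (a + k)"
proof -
  have "Q ^ (a + k) - Q ^ i = Q ^ (a + k) * (1 - (1 / Q) ^ (k - i + a))" if "i < k" for i
  proof -
    have "Q ^ (a + k) = Q ^ i * Q ^ (k - i + a)" using that by (simp add: add.commute flip: power_add)
    thus ?thesis using assms by (simp add: power_one_over field_simps)
  qed
  hence "(\<Prod>i<k. Q ^ (a + k) - Q ^ i) = (\<Prod>i<k. Q ^ (a + k) * (1 - (1 / Q) ^ (k - i + a)))"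
    by (intro prod.cong) auto
  also have "\<dots> = Q ^ ((a + k) * k) * (\<Prod>i<k. 1 - (1 / Q) ^ (k - i + a))"
    by (simp add: prod.distrib power_mult)
  finally show ?thesis
    using euler_prod_shift[of "1 / Q" a k] by (simp add: mult_ac add.commute)
qed

lemma gauss_binomial_eq_euler_prod:
  assumes "Q > 1"
  shows "gauss_binomial Q (a + k) k =
    Q ^ (a * k) * euler_prod (1 / Q) (a + k) / (euler_prod (1 / Q) a * euler_prod (1 / Q) k)"
proof -
  have nz: "euler_prod (1 / Q) m \<noteq> 0" for m using assms by (intro euler_prod_nonzero) simp
  have "(\<Prod>i<k. Q ^ (a + k) - Q ^ i) = Q ^ ((a + k) * k) * euler_prod (1 / Q) (a + k) / euler_prod (1 / Q) a"
    using prod_diff_power_eq_euler_prod[OF assms, where a=a and k=k] nz by (simp add: field_simps)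
  moreover have "(\<Prod>i<k. Q ^ k - Q ^ i) = Q ^ (k * k) * euler_prod (1 / Q) k"
    using prod_diff_power_eq_euler_prod[OF assms, where a=0 and k=k] by simp
  ultimately show ?thesis
    using assms by (simp add: gauss_binomial_def add_mult_distrib power_add)
qed

lemma h_fin_Suc: "h_fin Q (Suc l) = h_fin Q l * (Q ^ Suc l - 1)"
  by (simp add: h_fin_def)

lemma h_fin_pos: "Q > 1 \<Longrightarrow> h_fin Q l > 0"
  unfolding h_fin_def by (intro prod_pos) auto

text \<open>Both sides contain the product of all \<open>(q ^ 2) ^ i\<close> with
  \<open>i < l\<close>, after reversing the order on the left. What remains is the source of the
  constant \<open>q ^ l / h_fin (q ^ 2) l\<close>.\<close>

lemma prod_diff_power_eq_h_fin:
  assumes "q > 0"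
  shows "(\<Prod>i<l. (q\<^sup>2) ^ (l - i) / q) * h_fin (q\<^sup>2) l = q ^ l * (\<Prod>i<l. q ^ (2 * l) - q ^ (2 * i))"
proof -
  have "h_fin (q\<^sup>2) l = (\<Prod>i<l. (q\<^sup>2) ^ (l - i) - 1)"
    by (induction l) (simp_all add: h_fin_Suc prod.lessThan_Suc_shift mult.commute del: prod.lessThan_Suc,
      simp add: h_fin_def)
  moreover have "(\<Prod>i<l. (q\<^sup>2) ^ (l - i) / q) = (\<Prod>i<l. q * (q\<^sup>2) ^ i)"
  proof -
    have "(q\<^sup>2) ^ (l - i) / q = q * (q\<^sup>2) ^ (l - Suc i)" if "i < l" for i
    proof -
      have "l - i = Suc (l - Suc i)" using that by simp
      hence "(q\<^sup>2) ^ (l - i) / q = q\<^sup>2 * (q\<^sup>2) ^ (l - Suc i) / q" by (simp only: power_Suc)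
      thus ?thesis using assms by (simp add: power2_eq_square)
    qed
    thus ?thesis using prod.nat_diff_reindex[of "\<lambda>i. q * (q\<^sup>2) ^ i" l] by simp
  qed
  moreover have "q ^ (2 * l) - q ^ (2 * i) = (q\<^sup>2) ^ i * ((q\<^sup>2) ^ (l - i) - 1)" if "i < l" for i
  proof -
    have "2 * l = 2 * i + 2 * (l - i)" using that by simp
    hence "q ^ (2 * l) = (q\<^sup>2) ^ i * (q\<^sup>2) ^ (l - i)" by (simp only: power_add power_mult)
    thus ?thesis by (simp add: right_diff_distrib power_mult)
  qed
  hence "(\<Prod>i<l. q ^ (2 * l) - q ^ (2 * i)) = (\<Prod>i<l. (q\<^sup>2) ^ i * ((q\<^sup>2) ^ (l - i) - 1))"
    by (intro prod.cong) auto
  ultimately show ?thesis by (simp add: prod.distrib)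
qed

section \<open>From the exact quotient to the limit\<close>

lemma tends_to_dim_codimI:
  assumes "((\<lambda>(a, k). f (a + k) k) \<longlongrightarrow> L) (sequentially \<times>\<^sub>F sequentially)"
  shows "tends_to_dim_codim l f L"
  unfolding tends_to_dim_codim_def
proof safe
  fix \<epsilon> :: real assume "\<epsilon> > 0"
  hence "\<forall>\<^sub>F p in sequentially \<times>\<^sub>F sequentially. dist (case p of (a, k) \<Rightarrow> f (a + k) k) L < \<epsilon>"
    using assms by (simp add: tendsto_iff)
  then obtain N where N: "\<And>m n. m \<ge> N \<Longrightarrow> n \<ge> N \<Longrightarrow> \<bar>f (n + m) m - L\<bar> < \<epsilon>"
    unfolding eventually_prod_sequentially by (auto simp: dist_real_def)
  \<comment> \<open>The codimension \<open>n - k\<close> takes the role of \<open>a\<close>; by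
    \<open>k + l \<le> n\<close> the subtraction is not truncated.\<close>
  have "\<bar>f n k - L\<bar> < \<epsilon>" if "k + l \<le> n" "N \<le> k" "N \<le> n - k" for n k
    using N[of k "n - k"] that by simp
  thus "\<exists>M. \<forall>n k. 0 < n \<and> 0 < k \<and> l \<le> k \<and> k + l \<le> n \<and> M \<le> k \<and> M \<le> n - k \<longrightarrow> \<bar>f n k - L\<bar> < \<epsilon>"
    by blast
qed

text \<open>The hypothesis on \<open>c\<close> is the double count with \<open>j = k - l\<close> and
  \<open>s = a - l\<close>, where \<open>a\<close> is the codimension. Cancelling the common powers
  leaves a constant, a product of \<open>l\<close> correction factors and quotients of Euler
  products.\<close>

lemma quotient_eq_euler_prod:
  fixes q :: real
  assumes q: "q > 1" and al: "l \<le> a" "l \<le> k"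
    and c: "c * ((\<Prod>i<k-l. q ^ (2 * (l + (k - l - i))) / q * (1 - (- 1 / q) ^ (k - l - i)))
          * (\<Prod>i<l. q ^ (2 * l) - q ^ (2 * i)))
    = (\<Prod>i<k-l. q ^ (2 * (k - l - i + (2 * l + (a - l)))) / q
          * (1 - (- 1 / q) ^ (k - l - i + (2 * l + (a - l)))))
        * (\<Prod>i<l. q ^ (2 * (i + (2 * (l - i) + (a - l)))) / q
            * (1 + (q - 1) * (- 1 / q) ^ (2 * (l - i) + (a - l))) - q ^ (2 * i))"
  shows "c / gauss_binomial (q\<^sup>2) (a + k) k = q ^ l / h_fin (q\<^sup>2) l
     * (\<Prod>i<l. 1 + (q - 1) * (- 1 / q) ^ (2 * (l - i) + (a - l)) - q / (q\<^sup>2) ^ (2 * (l - i) + (a - l)))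
     * (euler_prod (- (1 / q)) (a + k) / (euler_prod (- (1 / q)) (a + l) * euler_prod (- (1 / q)) (k - l)))
     * (euler_prod ((1 / q)\<^sup>2) a * euler_prod ((1 / q)\<^sup>2) k / euler_prod ((1 / q)\<^sup>2) (a + k))"
proof -
  let ?x = "- (1 / q)" and ?y = "(1 / q)\<^sup>2"
  have x1: "\<bar>?x\<bar> < 1" "\<bar>?y\<bar> < 1" using q by (auto simp: abs_square_less_1)
  note nz = x1[THEN euler_prod_nonzero]
  define s where "s = a - l"
  define j where "j = k - l"
  have a: "a = l + s" and k: "k = j + l" using al by (auto simp: s_def j_def)
  have Q: "q\<^sup>2 > 1" using q by (simp add: one_less_power)
  let ?K = "\<Prod>i<j. q ^ (2 * (l + (j - i))) / q"
  let ?D = "\<Prod>i<l. q ^ (2 * l) - q ^ (2 * i)"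
  \<comment> \<open>Each factor of \<open>E\<close> is what remains of a factor of the isotropic
    count after its leading power of \<open>q\<close> is divided out.\<close>
  define E where "E = (\<Prod>i<l. 1 + (q - 1) * (- 1 / q) ^ (2 * (l - i) + s) - q / (q\<^sup>2) ^ (2 * (l - i) + s))"
  have K: "?K > 0" using q by (intro prod_pos) auto
  have D: "?D > 0" using q by (intro prod_pos) (auto simp: power_strict_increasing)
  have L1: "(\<Prod>i<j. q ^ (2 * (l + (j - i))) / q * (1 - (- 1 / q) ^ (j - i))) = ?K * euler_prod ?x j"
    unfolding prod.distrib using euler_prod_shift[of ?x 0 j] by simp
  \<comment> \<open>Compared with a code, each unit vector has an extra factor
    \<open>(q ^ 2) ^ a\<close> in the whole space. With the same factor from the \<open>l\<close>
    isotropic vectors this gives \<open>(q ^ 2) ^ (a * k)\<close>, the power in the Gaussian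
    binomial.\<close>
  have "(\<Prod>i<j. q ^ (2 * (j - i + (2 * l + s))) / q)
      = (\<Prod>i<j. (q\<^sup>2) ^ a * (q ^ (2 * (l + (j - i))) / q))"
  proof (intro prod.cong refl)
    fix i
    have "2 * (j - i + (2 * l + s)) = 2 * a + 2 * (l + (j - i))" by (simp add: a)
    thus "q ^ (2 * (j - i + (2 * l + s))) / q = (q\<^sup>2) ^ a * (q ^ (2 * (l + (j - i))) / q)"
      by (simp only: power_add power_mult times_divide_eq_right)
  qed
  also have "\<dots> = (q\<^sup>2) ^ (a * j) * ?K" by (simp only: prod.distrib prod_constant card_lessThan power_mult)
  finally have R1': "(\<Prod>i<j. q ^ (2 * (j - i + (2 * l + s))) / q) = (q\<^sup>2) ^ (a * j) * ?K" .
  have "j + (a + l) = a + k" "2 * l + s = a + l" by (simp_all add: a k)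
  hence "euler_prod ?x (a + l) * (\<Prod>i<j. 1 - (- 1 / q) ^ (j - i + (2 * l + s))) = euler_prod ?x (a + k)"
    using euler_prod_shift[of ?x "2 * l + s" j] by (simp only: minus_divide_left)
  hence "(\<Prod>i<j. 1 - (- 1 / q) ^ (j - i + (2 * l + s))) = euler_prod ?x (a + k) / euler_prod ?x (a + l)"
    using nz(1)[of "a + l"] by (simp only: eq_divide_eq mult.commute) simp
  hence R1: "(\<Prod>i<j. q ^ (2 * (j - i + (2 * l + s))) / q * (1 - (- 1 / q) ^ (j - i + (2 * l + s))))
      = (q\<^sup>2) ^ (a * j) * ?K * (euler_prod ?x (a + k) / euler_prod ?x (a + l))"
    by (simp only: prod.distrib R1')
  have "q ^ (2 * (i + (2 * (l - i) + s))) / q * (1 + (q - 1) * (- 1 / q) ^ (2 * (l - i) + s)) - q ^ (2 * i)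
     = (q\<^sup>2) ^ a * ((q\<^sup>2) ^ (l - i) / q)
        * (1 + (q - 1) * (- 1 / q) ^ (2 * (l - i) + s) - q / (q\<^sup>2) ^ (2 * (l - i) + s))"
    (is "?u / q * ?v - ?w = ?z * (?v - ?t)") if "i < l" for i
  proof -
    have "i + (2 * (l - i) + s) = a + (l - i)" using that by (simp add: a)
    hence u: "?z = ?u / q" by (simp only: power_mult power_add times_divide_eq_right)
    have "?u = ?w * (q\<^sup>2) ^ (2 * (l - i) + s)" by (simp only: add_mult_distrib2 power_add power_mult)
    hence "?u / q * ?t = ?w" using q by simp
    thus ?thesis unfolding u by (simp add: right_diff_distrib)
  qed
  hence "(\<Prod>i<l. q ^ (2 * (i + (2 * (l - i) + s))) / q
            * (1 + (q - 1) * (- 1 / q) ^ (2 * (l - i) + s)) - q ^ (2 * i))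
     = (\<Prod>i<l. (q\<^sup>2) ^ a * ((q\<^sup>2) ^ (l - i) / q)
        * (1 + (q - 1) * (- 1 / q) ^ (2 * (l - i) + s) - q / (q\<^sup>2) ^ (2 * (l - i) + s)))"
    by (intro prod.cong) auto
  also have "\<dots> = (q\<^sup>2) ^ (a * l) * (\<Prod>i<l. (q\<^sup>2) ^ (l - i) / q) * E"
    unfolding E_def by (simp only: prod.distrib prod_constant card_lessThan power_mult)
  finally have R2: "(\<Prod>i<l. q ^ (2 * (i + (2 * (l - i) + s))) / q
            * (1 + (q - 1) * (- 1 / q) ^ (2 * (l - i) + s)) - q ^ (2 * i))
     = (q\<^sup>2) ^ (a * l) * (\<Prod>i<l. (q\<^sup>2) ^ (l - i) / q) * E" .
  have h: "(\<Prod>i<l. (q\<^sup>2) ^ (l - i) / q) = q ^ l * ?D / h_fin (q\<^sup>2) l"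
    using prod_diff_power_eq_h_fin[of q l] q h_fin_pos[OF Q, of l] by (simp add: field_simps)
  have cancel: "c = X * Y * (t / h) * E * (A / (B * P))"
    if "c * (K * P * D) = (X * K * (A / B)) * (Y * (t * D / h) * E)" "K \<noteq> 0" "D \<noteq> 0" "P \<noteq> 0"
    for K P D X Y A B t h E :: real
  proof -
    have "c * P * (K * D) = X * Y * (t / h) * E * (A / B) * (K * D)" using that(1) by (simp add: mult_ac)
    hence "c * P = X * Y * (t / h) * E * (A / B)"
      by (rule mult_right_cancel[THEN iffD1, rotated]) (use that(2,3) in simp)
    hence "c = X * Y * (t / h) * E * (A / B) / P" by (rule nonzero_eq_divide_eq[OF that(4), THEN iffD2])
    thus ?thesis by simp
  qed
  have "c * (?K * euler_prod ?x j * ?D) = ((q\<^sup>2) ^ (a * j) * ?K * (euler_prod ?x (a + k) / euler_prod ?x (a + l)))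
      * ((q\<^sup>2) ^ (a * l) * (q ^ l * ?D / h_fin (q\<^sup>2) l) * E)"
    using c unfolding j_def[symmetric] s_def[symmetric] L1 R1 R2 h .
  moreover have "?K \<noteq> 0" "?D \<noteq> 0" using K D less_irrefl by metis+
  ultimately have "c = (q\<^sup>2) ^ (a * j) * (q\<^sup>2) ^ (a * l) * (q ^ l / h_fin (q\<^sup>2) l)
      * E * (euler_prod ?x (a + k) / (euler_prod ?x (a + l) * euler_prod ?x j))"
    by (rule cancel) (rule nz(1))
  hence c_eq: "c = (q\<^sup>2) ^ (a * k) * (q ^ l / h_fin (q\<^sup>2) l)
      * E * (euler_prod ?x (a + k) / (euler_prod ?x (a + l) * euler_prod ?x j))"
    by (simp only: k power_add add_mult_distrib2)
  have y: "1 / q\<^sup>2 = ?y" by (simp add: power_one_over)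
  show ?thesis
    unfolding gauss_binomial_eq_euler_prod[OF Q] y E_def[symmetric] j_def[symmetric] s_def[symmetric] c_eq
    using q nz by (simp add: field_simps)
qed

text \<open>The correction factors tend to \<open>1\<close> and each Euler product tends to its
  nonzero limit, which leaves \<open>?G / ?f\<close> times the constant. The identity for the
  product at a negative argument then eliminates \<open>?f\<close>.\<close>

lemma euler_prod_quotient_limit:
  fixes q :: real
  assumes q: "q > 1"
  shows "((\<lambda>(a, k). q ^ l / h_fin (q\<^sup>2) l
     * (\<Prod>i<l. 1 + (q - 1) * (- 1 / q) ^ (2 * (l - i) + (a - l)) - q / (q\<^sup>2) ^ (2 * (l - i) + (a - l)))
     * (euler_prod (- (1 / q)) (a + k) / (euler_prod (- (1 / q)) (a + l) * euler_prod (- (1 / q)) (k - l)))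
     * (euler_prod ((1 / q)\<^sup>2) a * euler_prod ((1 / q)\<^sup>2) k / euler_prod ((1 / q)\<^sup>2) (a + k)))
    \<longlongrightarrow> q ^ l * g_inf q * g_inf (q ^ 4) / (h_fin (q\<^sup>2) l * g_inf (q\<^sup>2) * g_inf (q\<^sup>2)))
      (sequentially \<times>\<^sub>F sequentially)"
proof -
  let ?F = "sequentially \<times>\<^sub>F sequentially :: (nat \<times> nat) filter"
  let ?x = "- (1 / q)" and ?y = "(1 / q)\<^sup>2"
  have x1: "\<bar>1 / q\<bar> < 1" "\<bar>?x\<bar> < 1" "\<bar>?y\<bar> < 1" "\<bar>(1 / q) ^ 4\<bar> < 1"
    using q abs_power_Suc_less_one[of "1 / q" 3] abs_power_Suc_less_one[of "1 / q" 1]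
    by (simp_all add: eval_nat_numeral)
  note lim = x1[THEN euler_prod_convergent(1)]
  note nz = x1[THEN euler_prod_convergent(2)]
  have fst: "filterlim (\<lambda>p. fst p) sequentially ?F" and snd: "filterlim (\<lambda>p. snd p) sequentially ?F"
    by (rule filterlim_fst filterlim_snd)+
  have sum: "filterlim (\<lambda>p. fst p + snd p) sequentially ?F"
    by (rule filterlim_at_top_mono[OF fst]) simp
  have fst_add: "filterlim (\<lambda>p. fst p + c) sequentially ?F" for c
    by (rule filterlim_at_top_mono[OF fst]) simp
  have fst_diff: "filterlim (\<lambda>p. c + (fst p - l)) sequentially ?F" for c
    by (rule filterlim_at_top_mono[OF filterlim_compose[OF filterlim_minus_const_nat_at_top[of l] fst]]) simp
  have snd_diff: "filterlim (\<lambda>p. snd p - l) sequentially ?F"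
    by (rule filterlim_compose[OF filterlim_minus_const_nat_at_top snd])
  have pow1: "(\<lambda>m. (- 1 / q) ^ m) \<longlonglongrightarrow> 0" using x1 by (intro LIMSEQ_power_zero) simp
  have "(\<lambda>m. q * ?y ^ m) \<longlonglongrightarrow> q * 0" using x1 by (intro tendsto_mult tendsto_const LIMSEQ_power_zero) simp
  hence pow2: "(\<lambda>m. q / (q\<^sup>2) ^ m) \<longlonglongrightarrow> 0" by (simp add: power_one_over)
  have E: "((\<lambda>p. \<Prod>i<l. 1 + (q - 1) * (- 1 / q) ^ (2 * (l - i) + (fst p - l))
      - q / (q\<^sup>2) ^ (2 * (l - i) + (fst p - l))) \<longlongrightarrow> (\<Prod>i<l. 1 + (q - 1) * 0 - 0)) ?F"
    by (intro tendsto_prod tendsto_diff tendsto_add tendsto_mult tendsto_const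
        filterlim_compose[OF pow1 fst_diff] filterlim_compose[OF pow2 fst_diff])
  let ?f = "lim (euler_prod ?x)" and ?G = "lim (euler_prod ?y)"
  have L: "((\<lambda>p. q ^ l / h_fin (q\<^sup>2) l
     * (\<Prod>i<l. 1 + (q - 1) * (- 1 / q) ^ (2 * (l - i) + (fst p - l)) - q / (q\<^sup>2) ^ (2 * (l - i) + (fst p - l)))
     * (euler_prod ?x (fst p + snd p) / (euler_prod ?x (fst p + l) * euler_prod ?x (snd p - l)))
     * (euler_prod ?y (fst p) * euler_prod ?y (snd p) / euler_prod ?y (fst p + snd p)))
    \<longlongrightarrow> q ^ l / h_fin (q\<^sup>2) l * (\<Prod>i<l. 1 + (q - 1) * 0 - 0) * (?f / (?f * ?f)) * (?G * ?G / ?G)) ?F"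
    using nz
    by (intro tendsto_mult tendsto_divide tendsto_const E
        lim[THEN filterlim_compose, OF sum] lim[THEN filterlim_compose, OF fst]
        lim[THEN filterlim_compose, OF snd] lim[THEN filterlim_compose, OF fst_add]
        lim[THEN filterlim_compose, OF snd_diff] no_zero_divisors) auto
  have g: "g_inf q = lim (euler_prod (1 / q))" "g_inf (q\<^sup>2) = ?G" "g_inf (q ^ 4) = lim (euler_prod ((1 / q) ^ 4))"
    by (simp_all add: g_inf_def g_fin_eq_euler_prod power_one_over)
  have "?f * g_inf q * g_inf (q ^ 4) = ?G ^ 3" unfolding g using euler_prod_minus_lim[OF x1(1)] .
  hence G: "?G / ?f = g_inf q * g_inf (q ^ 4) / (?G * ?G)"
    using nz by (simp add: field_simps power3_eq_cube)
  have "q ^ l / h_fin (q\<^sup>2) l * (\<Prod>i<l. 1 + (q - 1) * 0 - 0) * (?f / (?f * ?f)) * (?G * ?G / ?G)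
     = q ^ l / h_fin (q\<^sup>2) l * (?G / ?f)"
    using nz by simp
  also have "\<dots> = q ^ l / h_fin (q\<^sup>2) l * (g_inf q * g_inf (q ^ 4) / (?G * ?G))"
    by (simp only: G)
  finally have "q ^ l / h_fin (q\<^sup>2) l * (\<Prod>i<l. 1 + (q - 1) * 0 - 0) * (?f / (?f * ?f)) * (?G * ?G / ?G)
     = q ^ l * g_inf q * g_inf (q ^ 4) / (h_fin (q\<^sup>2) l * g_inf (q\<^sup>2) * g_inf (q\<^sup>2))"
    unfolding g(2) by simp
  thus ?thesis using L by (simp only: case_prod_unfold)
qed

lemma card_HHull_quotient_limit:
  fixes q l :: nat
  assumes "primepow q" "CARD('a::{field,finite}) = q ^ 2"
  shows "tends_to_dim_codim l
           (\<lambda>n k. real (card (HHull q n k l :: (nat \<Rightarrow> 'a) set set)) / gauss_binomial (real q ^ 2) n k)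
           (real q ^ l * g_inf (real q) * g_inf (real q ^ 4)
              / (h_fin (real q ^ 2) l * g_inf (real q ^ 2) * g_inf (real q ^ 2)))"
proof -
  have q: "real q > 1" using primepow_gt_Suc_0[OF assms(1)] by simp
  let ?c = "\<lambda>n k. real (card (HHull q n k l :: (nat \<Rightarrow> 'a) set set))"
  show ?thesis
  proof (rule tends_to_dim_codimI, rule Lim_transform_eventually[OF euler_prod_quotient_limit[OF q, of l]])
    show "\<forall>\<^sub>F p in sequentially \<times>\<^sub>F sequentially. (case p of (a, k) \<Rightarrow>
        real q ^ l / h_fin ((real q)\<^sup>2) l
     * (\<Prod>i<l. 1 + (real q - 1) * (- 1 / real q) ^ (2 * (l - i) + (a - l))
          - real q / ((real q)\<^sup>2) ^ (2 * (l - i) + (a - l)))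
     * (euler_prod (- (1 / real q)) (a + k)
          / (euler_prod (- (1 / real q)) (a + l) * euler_prod (- (1 / real q)) (k - l)))
     * (euler_prod ((1 / real q)\<^sup>2) a * euler_prod ((1 / real q)\<^sup>2) k
          / euler_prod ((1 / real q)\<^sup>2) (a + k)))
     = (case p of (a, k) \<Rightarrow> ?c (a + k) k / gauss_binomial ((real q)\<^sup>2) (a + k) k)"
      (is "eventually ?P _")
      unfolding eventually_prod_sequentially
    proof (intro exI[of _ l] allI impI)
      \<comment> \<open>From \<open>l\<close> on, the subtractions in the closed form are genuine.
        The length \<open>a + k\<close> varies along the limit, so the locale is interpreted
        separately for each pair.\<close>
      fix k a assume al: "l \<le> k" "l \<le> a"
      interpret hermitian q "TYPE('a)" "a + k" by unfold_locales (use assms in auto)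
      have "a + k = (k - l) + (2 * l + (a - l))" and k: "k - l + l = k" using al by simp_all
      from card_HHull[OF this(1)] show "?P (a, k)"
        unfolding prod.case
        by (intro quotient_eq_euler_prod[symmetric, OF q al(2,1)]) (simp only: k)
    qed
  qed
qed

theorem theorem3p15:
  fixes q l :: nat
  assumes "primepow q"
    and "CARD('a::{field,finite}) = q ^ 2"
  shows "tends_to_dim_codim l
           (\<lambda>n k. real (card (HHull q n k l :: (nat \<Rightarrow> 'a) set set)) / gauss_binomial (real q ^ 2) n k)
           (real q ^ l * g_inf (real q) * g_inf (real q ^ 4)
              / (h_fin (real q ^ 2) l * g_inf (real q ^ 2) * g_inf (real q ^ 2)))
       \<and> tends_to_dim_codim 0
           (\<lambda>n k. real (card (HHull q n k 0 :: (nat \<Rightarrow> 'a) set set)) / gauss_binomial (real q ^ 2) n k)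
           (g_inf (real q) * g_inf (real q ^ 4) / (g_inf (real q ^ 2) * g_inf (real q ^ 2)))"
proof
  show "tends_to_dim_codim 0
           (\<lambda>n k. real (card (HHull q n k 0 :: (nat \<Rightarrow> 'a) set set)) / gauss_binomial (real q ^ 2) n k)
           (g_inf (real q) * g_inf (real q ^ 4) / (g_inf (real q ^ 2) * g_inf (real q ^ 2)))"
    using card_HHull_quotient_limit[OF assms, of 0] by (simp add: h_fin_def)
qed (rule card_HHull_quotient_limit[OF assms])

end
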